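(* Let $\sigma$ be a permutation of size $n$ whose substitution decomposition is $\pi[\alpha_1,\dots,\alpha_k]$. For any $I\in P_\bullet(\sigma)$, it holds that \[ \mu(I,[1,n])=\begin{cases} 1 & \text{if } I=[1,n],\\ -1 & \text{if } I \text{ is covered by } [1,n] \text{ (i.e., } I \text{ is a coatom)},\\ k-1 & \text{if } I=\emptyset \text{ and } \pi \text{ is either simple or } 12 \text{ or } 21,\\ 1 & \text{if } \pi \text{ is } 12\dots k \text{ or } k\dots21 \text{ for some } k\ge3 \text{ and } I \text{ is covered by the two coatoms of } P_\bullet(\sigma),\\ 0 & \text{otherwise,} \end{cases} \] where $\mu$ is the Möbius function of $P_\bullet(\sigma)$.
   Context: A permutation $\sigma=\sigma(1)\dots\sigma(n)$ of size $n$ is a word on $\{1,\dots,n\}$ containing each letter exactly once. A non-empty interval of $\sigma$ is a set of values $[j,j+h]=\{j,\dots,j+h\}$ such that $\{\sigma(i),\dots,\sigma(i+h)\}=[j,j+h]$ for some $i$; the empty set is also regarded as an interval. $P_\bullet(\sigma)$ is the poset of all intervals of $\sigma$ (including $\emptyset$, the singletons and $[1,n]=\{1,\dots,n\}$) ordered by inclusion; $[1,n]$ is its maximum. A coatom is an element covered by the maximum. A permutation is simple if it has size at least $4$ and its only non-empty intervals are the singletons and $[1,n]$. For $\pi$ of size $k$ and permutations $\alpha_1,\dots,\alpha_k$, the inflation $\pi[\alpha_1,\dots,\alpha_k]$ is the permutation obtained from $\pi$ by replacing each $\pi(i)$ by a block $I_i$ of consecutive positions whose values form an interval, such that all elements of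 $I_i$ are larger than all elements of $I_j$ whenever $\pi(i)>\pi(j)$, and the elements of $I_i$ form a sequence order-isomorphic to $\alpha_i$. Write $\oplus[\alpha_1,\dots,\alpha_k]$ (resp. $\ominus[\alpha_1,\dots,\alpha_k]$) when $\pi=12\dots k$ (resp. $\pi=k\dots21$), $k\ge2$. A permutation is $\oplus$-indecomposable (resp. $\ominus$-indecomposable) if it is not of the form $\oplus[\alpha_1,\dots,\alpha_k]$ (resp. $\ominus[\alpha_1,\dots,\alpha_k]$) with $k\ge2$. Every permutation of size at least $2$ can be uniquely written as $\pi[\alpha_1,\dots,\alpha_k]$, called its substitution decomposition, with either $\pi$ simple; or $\pi=12\dots k$, $k\ge2$, and all $\alpha_i$ $\oplus$-indecomposable; or $\pi=k\dots21$, $k\ge2$, and all $\alpha_i$ $\ominus$-indecomposable. (In particular a permutation having a substitution decomposition has size at least $2$.) The Möbius function of a finite poset $(P,\le)$ is defined recursively by $\mu(a,b)=1$ if $a=b$, $\mu(a,b)=-\sum_{x:\,a<x\le b}\mu(x,b)$ if $a<b$, and $\mu(a,b)=0$ otherwise. *)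

theory Defs
  imports "HOL-Combinatorics.Multiset_Permutations"
begin

section \<open>Permutations as words\<close>

text \<open>
  A permutation of size n is the word \<sigma>(1) ... \<sigma>(n), represented as a list. The letters
  are 1, ..., n, but list positions start at 0, so \<sigma>(i) is \<open>\<sigma> ! (i - 1)\<close>. Sizes are
  positive: with empty blocks allowed, every permutation would be decomposable and
  substitution decompositions would not be unique.
\<close>

definition is_perm :: "nat \<Rightarrow> nat list \<Rightarrow> bool" where
  "is_perm n \<sigma> \<longleftrightarrow> 1 \<le> n \<and> \<sigma> \<in> permutations_of_set {1..n}"

definition increasing_perm :: "nat \<Rightarrow> nat list" where
  "increasing_perm k = [1..<Suc k]"

definition decreasing_perm :: "nat \<Rightarrow> nat list" where
  "decreasing_perm k = rev [1..<Suc k]"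

text \<open>
  The underlying set of the poset of intervals; its order is the inclusion of sets.
\<close>

definition intervals :: "nat list \<Rightarrow> nat set set" where
  "intervals \<sigma> = {J. J = {} \<or>
     (\<exists>i j h. i + h < length \<sigma> \<and> J = {j..j + h} \<and> (\<lambda>m. \<sigma> ! m) ` {i..i + h} = J)}"

definition simple_perm :: "nat list \<Rightarrow> bool" where
  "simple_perm \<sigma> \<longleftrightarrow> is_perm (length \<sigma>) \<sigma> \<and> 4 \<le> length \<sigma> \<and>
     (\<forall>J \<in> intervals \<sigma>. J \<noteq> {} \<longrightarrow> is_singleton J \<or> J = {1..length \<sigma>})"

section \<open>Inflations and substitution decompositions\<close>

definition order_isomorphic :: "nat list \<Rightarrow> nat list \<Rightarrow> bool" where
  "order_isomorphic xs ys \<longleftrightarrow> length xs = length ys \<and>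
     (\<forall>i < length xs. \<forall>j < length xs. xs ! i < xs ! j \<longleftrightarrow> ys ! i < ys ! j)"

text \<open>
  \<open>is_inflation \<pi> \<alpha>s \<sigma>\<close> says that \<sigma> is the inflation \<pi>[\<alpha>(1), ..., \<alpha>(k)]; the list \<open>Bs\<close>
  consists of the blocks of consecutive letters of \<sigma> that replace the letters of \<pi>.
\<close>

definition is_inflation :: "nat list \<Rightarrow> nat list list \<Rightarrow> nat list \<Rightarrow> bool" where
  "is_inflation \<pi> \<alpha>s \<sigma> \<longleftrightarrow>
     is_perm (length \<pi>) \<pi> \<and> length \<alpha>s = length \<pi> \<and>
     (\<forall>\<alpha> \<in> set \<alpha>s. is_perm (length \<alpha>) \<alpha>) \<and> is_perm (length \<sigma>) \<sigma> \<and>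
     (\<exists>Bs. length Bs = length \<pi> \<and> concat Bs = \<sigma> \<and>
        (\<forall>i < length \<pi>. set (Bs ! i) \<in> intervals \<sigma> \<and> order_isomorphic (Bs ! i) (\<alpha>s ! i)) \<and>
        (\<forall>i < length \<pi>. \<forall>j < length \<pi>. \<pi> ! i > \<pi> ! j \<longrightarrow>
           (\<forall>x \<in> set (Bs ! i). \<forall>y \<in> set (Bs ! j). x > y)))"

definition oplus_indecomposable :: "nat list \<Rightarrow> bool" where
  "oplus_indecomposable \<sigma> \<longleftrightarrow>
     \<not> (\<exists>k \<alpha>s. 2 \<le> k \<and> is_inflation (increasing_perm k) \<alpha>s \<sigma>)"

definition ominus_indecomposable :: "nat list \<Rightarrow> bool" where
  "ominus_indecomposable \<sigma> \<longleftrightarrow>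
     \<not> (\<exists>k \<alpha>s. 2 \<le> k \<and> is_inflation (decreasing_perm k) \<alpha>s \<sigma>)"

definition substitution_decomposition ::
  "nat list \<Rightarrow> nat list \<Rightarrow> nat list list \<Rightarrow> bool" where
  "substitution_decomposition \<sigma> \<pi> \<alpha>s \<longleftrightarrow> is_inflation \<pi> \<alpha>s \<sigma> \<and>
     (simple_perm \<pi> \<or>
      (\<exists>k \<ge> 2. \<pi> = increasing_perm k \<and> (\<forall>\<alpha> \<in> set \<alpha>s. oplus_indecomposable \<alpha>)) \<or>
      (\<exists>k \<ge> 2. \<pi> = decreasing_perm k \<and> (\<forall>\<alpha> \<in> set \<alpha>s. ominus_indecomposable \<alpha>)))"

section \<open>Finite posets\<close>

text \<open>A finite poset is given by a finite subset \<open>P\<close> of an ordered type.\<close>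

definition covered_by :: "'a::order set \<Rightarrow> 'a \<Rightarrow> 'a \<Rightarrow> bool" where
  "covered_by P a b \<longleftrightarrow> a \<in> P \<and> b \<in> P \<and> a < b \<and> \<not> (\<exists>c \<in> P. a < c \<and> c < b)"

text \<open>The elements covered by \<open>m\<close>, which is meant to be the maximum of \<open>P\<close>.\<close>

definition coatoms :: "'a::order set \<Rightarrow> 'a \<Rightarrow> 'a set" where
  "coatoms P m = {c. covered_by P c m}"

text \<open>
  The recursion is on the first argument. The test for finiteness only makes the recursion
  terminate; the value 0 for infinite \<open>P\<close> has no meaning.
\<close>

function moebius :: "'a::order set \<Rightarrow> 'a \<Rightarrow> 'a \<Rightarrow> int" where
  "moebius P a b =
     (if \<not> finite P then 0
      else if a = b then 1
      else if a < b then - (\<Sum>x \<in> {x \<in> P. a < x \<and> x \<le> b}. moebius P x b)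
      else 0)"
  by pat_completeness auto
termination
proof (relation "measure (\<lambda>(P, a, b). card {x \<in> P. a < x})", goal_cases)
  case 1
  show ?case by simp
next
  case (2 P a b x)
  then have "{y \<in> P. x < y} \<subset> {y \<in> P. a < y}" by auto
  then show ?case using 2 by (auto intro!: psubset_card_mono)
qed

declare moebius.simps [simp del]

lemma moebius_eqs:
  assumes "finite P"
  shows "moebius P a a = 1"
    and "a < b \<Longrightarrow> moebius P a b = - (\<Sum>x \<in> {x \<in> P. a < x \<and> x \<le> b}. moebius P x b)"
    and "\<not> a \<le> b \<Longrightarrow> moebius P a b = 0"
  using assms by (subst moebius.simps; auto)+

lemma finite_intervals: "finite (intervals \<sigma>)"
proof (rule finite_subset)
  show "intervals \<sigma> \<subseteq> Pow (set \<sigma>)"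
  proof
    fix J assume "J \<in> intervals \<sigma>"
    then consider "J = {}" | i h where "i + h < length \<sigma>" "(\<lambda>m. \<sigma> ! m) ` {i..i + h} = J"
      unfolding intervals_def by blast
    then show "J \<in> Pow (set \<sigma>)"
      by cases auto
  qed
qed simp

end

theory Submission
  imports Defs
begin

text \<open>
  Intervals of a permutation are closed under intersection, so \<open>\<mu>(I, [1, n])\<close> vanishes unless
  \<open>I\<close> is an intersection of coatoms (the whole set counting as the empty intersection). This is
  the lemma \<open>moebius_eq_0_unless_coatom_meet\<close>, valid in every finite family of sets closed under
  intersection. It remains to find the coatoms and their intersections.

  A set of values is an interval iff it is convex and the set of positions of its elements is
  convex. Hence the union of two overlapping intervals is an interval, and so is their difference
  if neither contains the other. These rules leave two configurations.

  If two coatoms overlap, their union is everything, and there is no third coatom: one of any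
  three would contain both \<open>1\<close> and \<open>n\<close>. The intersection of the two is covered by both, has
  Moebius value \<open>-(1 - 1 - 1) = 1\<close>, and all intervals strictly below it have the value \<open>0\<close>,
  as do all others that are proper and not coatoms (\<open>moebius_intervals_overlapping\<close>). This happens when \<open>\<pi>\<close> is monotone of size at least \<open>3\<close>,
  because all blocks but the first and all blocks but the last then form overlapping intervals
  (\<open>overlapping_coatoms_exist\<close>).

  If \<open>\<pi>\<close> is simple or of size \<open>2\<close>, the coatoms are the \<open>k\<close> blocks, which are disjoint, so that
  the only other intersection of coatoms is the empty set, with value \<open>-(1 - k)\<close>
  (\<open>moebius_intervals_blocks\<close>). For simple \<open>\<pi>\<close>, the blocks met by an interval of \<open>\<sigma>\<close> form an
  interval of \<open>\<pi>\<close>; if a proper interval meets all blocks, removing from it a block that it does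
  not contain yields a forbidden interval of \<open>\<pi>\<close> (\<open>proper_interval_subset_block_simple\<close>). For size \<open>2\<close>, a proper
  interval meeting both blocks would cut one of them into a sum in the direction of \<open>\<pi>\<close>, against
  its indecomposability (\<open>proper_interval_subset_block_two\<close>).
\<close>

section \<open>The Moebius function of a family of sets closed under intersection\<close>

lemma moebius_sum_zero:
  fixes a b :: "'a::order"
  assumes "finite P" "a \<in> P" "a < b"
  shows "(\<Sum>x \<in> {x \<in> P. a \<le> x \<and> x \<le> b}. moebius P x b) = 0"
proof -
  have "{x \<in> P. a \<le> x \<and> x \<le> b} = insert a {x \<in> P. a < x \<and> x \<le> b}"
    using assms by auto
  then show ?thesis
    using assms by (simp add: moebius_eqs(2)[OF assms(1,3)])
qed

lemma moebius_coatom: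
  fixes c m :: "'a::order"
  assumes "finite P" "covered_by P c m"
  shows "moebius P c m = -1"
proof -
  have "{x \<in> P. c < x \<and> x \<le> m} = {m}"
    using assms(2) by (auto simp: covered_by_def order.order_iff_strict)
  then show ?thesis
    using assms by (simp add: moebius_eqs covered_by_def)
qed

lemma exists_coatom_above:
  fixes a m :: "'a::order"
  assumes "finite P" "m \<in> P" "a \<in> P" "a < m"
  obtains c where "c \<in> coatoms P m" "a \<le> c"
proof -
  let ?A = "{x \<in> P. x < m}"
  have "finite ?A" "a \<in> ?A" using assms by auto
  then obtain c where c: "c \<in> ?A" "a \<le> c" "\<forall>b \<in> ?A. c \<le> b \<longrightarrow> c = b"
    using finite_has_maximal2[of ?A a] by auto
  then have "covered_by P c m"
    using assms(2) by (auto simp: covered_by_def)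
  with c(2) that show ?thesis by (auto simp: coatoms_def)
qed

lemma finite_coatoms: "finite P \<Longrightarrow> finite (coatoms P m)"
  by (rule finite_subset[of _ P]) (auto simp: coatoms_def covered_by_def)

lemma Inter_mem_of_closed:
  assumes "finite F" "F \<noteq> {}" "F \<subseteq> P" "\<And>A B. A \<in> P \<Longrightarrow> B \<in> P \<Longrightarrow> A \<inter> B \<in> P"
  shows "\<Inter>F \<in> P"
  using assms by (induction F rule: finite_ne_induct) auto

locale intersection_family =
  fixes P :: "'a set set" and m :: "'a set"
  assumes finite_family: "finite P"
    and top_mem: "m \<in> P"
    and subset_top: "A \<in> P \<Longrightarrow> A \<subseteq> m"
    and Int_mem: "A \<in> P \<Longrightarrow> B \<in> P \<Longrightarrow> A \<inter> B \<in> P"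
begin

definition coatom_meet :: "'a set \<Rightarrow> 'a set" where
  "coatom_meet I = \<Inter>{C \<in> coatoms P m. I \<subseteq> C}"

lemma subset_coatom_meet: "I \<subseteq> coatom_meet I"
  by (auto simp: coatom_meet_def)

lemma coatom_meet_mono: "I \<subseteq> J \<Longrightarrow> coatom_meet I \<subseteq> coatom_meet J"
  by (auto simp: coatom_meet_def)

lemma coatom_meet_mem:
  assumes "I \<in> P" "I \<noteq> m"
  shows "coatom_meet I \<in> P" "coatom_meet I \<subset> m"
proof -
  have "I \<subset> m" using assms subset_top by auto
  then obtain C where C: "C \<in> coatoms P m" "I \<subseteq> C"
    using exists_coatom_above[OF finite_family top_mem assms(1)] by metis
  show "coatom_meet I \<in> P"
    unfolding coatom_meet_def
  proof (rule Inter_mem_of_closed)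
    show "finite {C \<in> coatoms P m. I \<subseteq> C}"
      using finite_coatoms[OF finite_family] by auto
    show "{C \<in> coatoms P m. I \<subseteq> C} \<noteq> {}" using C by auto
    show "{C \<in> coatoms P m. I \<subseteq> C} \<subseteq> P" by (auto simp: coatoms_def covered_by_def)
  qed (rule Int_mem)
  have "C \<subset> m" using C(1) by (simp add: coatoms_def covered_by_def)
  moreover have "coatom_meet I \<subseteq> C" using C by (auto simp: coatom_meet_def)
  ultimately show "coatom_meet I \<subset> m" by (rule subset_psubset_trans[rotated])
qed

text \<open>
  Taking the meet of the coatoms above is a closure operator on the proper elements. By
  induction from the top, the elements above \<open>I\<close> that are not closed contribute nothing to the
  recursion for \<open>I\<close>; the closed ones above a non-closed \<open>I\<close> are those above its closure, and the
  Moebius values there add up to zero.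
\<close>

lemma moebius_eq_0_unless_coatom_meet:
  assumes "I \<in> P" "I \<noteq> m" "coatom_meet I \<noteq> I"
  shows "moebius P I m = 0"
  using assms
proof (induction "card {x \<in> P. I \<subset> x}" arbitrary: I rule: less_induct)
  case less
  let ?Q = "coatom_meet I"
  let ?up = "{x \<in> P. I < x \<and> x \<le> m}" and ?upQ = "{x \<in> P. ?Q \<le> x \<and> x \<le> m}"
  have "I \<subset> m" using less.prems subset_top by auto
  have "I \<subset> ?Q" using less.prems subset_coatom_meet by blast
  have "moebius P x m = 0" if x: "x \<in> ?up - ?upQ" for x
  proof (rule less.hyps)
    have "I \<subset> x" "x \<subseteq> m" and Qx: "\<not> ?Q \<subseteq> x" using x by auto
    have "{y \<in> P. x \<subset> y} \<subset> {y \<in> P. I \<subset> y}" using \<open>I \<subset> x\<close> x by auto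
    then show "card {y \<in> P. x \<subset> y} < card {y \<in> P. I \<subset> y}"
      using finite_family by (simp add: psubset_card_mono)
    show "x \<in> P" using x by simp
    show "x \<noteq> m" using Qx coatom_meet_mem(2)[OF less.prems(1,2)] by auto
    show "coatom_meet x \<noteq> x"
      using Qx coatom_meet_mono[of I x] \<open>I \<subset> x\<close> by auto
  qed
  moreover have "?upQ \<subseteq> ?up" using \<open>I \<subset> ?Q\<close> by auto
  ultimately have "sum (\<lambda>x. moebius P x m) ?up = sum (\<lambda>x. moebius P x m) ?upQ"
    using finite_family by (intro sum.mono_neutral_right) auto
  also have "\<dots> = 0"
    using coatom_meet_mem[OF less.prems(1,2)] finite_family by (intro moebius_sum_zero) auto
  finally show ?case
    using moebius_eqs(2)[OF finite_family] \<open>I \<subset> m\<close> by simp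
qed

text \<open>
  A proper nonempty set lies in exactly one of the coatoms if these are disjoint, so the meet of
  the coatoms above it is a coatom.
\<close>

lemma moebius_disjoint_coatoms:
  assumes disj: "\<And>C D. C \<in> coatoms P m \<Longrightarrow> D \<in> coatoms P m \<Longrightarrow> C \<noteq> D \<Longrightarrow> C \<inter> D = {}"
    and I: "I \<in> P" "I \<noteq> m" "I \<notin> coatoms P m" "I \<noteq> {}"
  shows "moebius P I m = 0"
proof (rule moebius_eq_0_unless_coatom_meet[OF I(1,2)])
  have "I \<subset> m" using I subset_top by auto
  then obtain C where C: "C \<in> coatoms P m" "I \<subseteq> C"
    using exists_coatom_above[OF finite_family top_mem I(1)] by metis
  have "{D \<in> coatoms P m. I \<subseteq> D} = {C}"
    using C disj[of C] I(4) by blast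
  then show "coatom_meet I \<noteq> I"
    using C I(3) by (auto simp: coatom_meet_def)
qed

lemma moebius_empty_disjoint_coatoms:
  assumes disj: "\<And>C D. C \<in> coatoms P m \<Longrightarrow> D \<in> coatoms P m \<Longrightarrow> C \<noteq> D \<Longrightarrow> C \<inter> D = {}"
    and "m \<noteq> {}" "{} \<notin> coatoms P m"
  shows "moebius P {} m = int (card (coatoms P m)) - 1"
proof -
  let ?C = "coatoms P m"
  have fin: "finite (insert m ?C)" by (simp add: finite_coatoms finite_family)
  have "m \<notin> ?C" by (auto simp: coatoms_def covered_by_def)
  have "{} \<subset> m" using assms(2) by auto
  have "(\<Sum>x \<in> {x \<in> P. {} < x \<and> x \<le> m}. moebius P x m)
      = (\<Sum>x \<in> insert m ?C. moebius P x m)"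
  proof (rule sum.mono_neutral_right)
    show "finite {x \<in> P. {} < x \<and> x \<le> m}" using finite_family by simp
    show "insert m ?C \<subseteq> {x \<in> P. {} < x \<and> x \<le> m}"
      using assms top_mem by (auto simp: coatoms_def covered_by_def)
    show "\<forall>x \<in> {x \<in> P. {} < x \<and> x \<le> m} - insert m ?C. moebius P x m = 0"
      using moebius_disjoint_coatoms[OF disj] by auto
  qed
  also have "\<dots> = moebius P m m + (\<Sum>x \<in> ?C. moebius P x m)"
    using fin \<open>m \<notin> ?C\<close> by simp
  also have "(\<Sum>x \<in> ?C. moebius P x m) = (\<Sum>x \<in> ?C. -1)"
    by (rule sum.cong) (auto simp: coatoms_def intro: moebius_coatom finite_family)
  finally show ?thesis
    using moebius_eqs(1,2)[OF finite_family] \<open>{} \<subset> m\<close> by simp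
qed

lemma moebius_two_coatoms:
  assumes two: "coatoms P m = {C, D}" "C \<noteq> D"
    and I: "I \<in> P" "I \<noteq> m" "I \<notin> coatoms P m" "I \<noteq> C \<inter> D"
  shows "moebius P I m = 0"
proof (rule moebius_eq_0_unless_coatom_meet[OF I(1,2)])
  have "I \<subset> m" using I subset_top by auto
  then obtain E where E: "E \<in> coatoms P m" "I \<subseteq> E"
    using exists_coatom_above[OF finite_family top_mem I(1)] by metis
  then have "{F \<in> coatoms P m. I \<subseteq> F} \<noteq> {}" "{F \<in> coatoms P m. I \<subseteq> F} \<subseteq> {C, D}"
    using two(1) by blast+
  then have "{F \<in> coatoms P m. I \<subseteq> F} \<in> {{C}, {D}, {C, D}}"
    by blast
  then have "coatom_meet I \<in> {C, D, C \<inter> D}"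
    by (elim insertE) (simp_all add: coatom_meet_def)
  then show "coatom_meet I \<noteq> I"
    using I two(1) by blast
qed

lemma moebius_Int_two_coatoms:
  assumes two: "coatoms P m = {C, D}" "C \<noteq> D"
    and cov: "covered_by P (C \<inter> D) C" "covered_by P (C \<inter> D) D"
  shows "moebius P (C \<inter> D) m = 1"
proof -
  have CD: "covered_by P C m" "covered_by P D m"
    using two by (auto simp: coatoms_def)
  have "x \<in> {m, C, D}" if "x \<in> P" "C \<inter> D \<subset> x" for x
  proof (cases "x = m")
    case False
    then have "x \<subset> m" using that subset_top by auto
    then obtain E where "E \<in> {C, D}" "x \<subseteq> E"
      using exists_coatom_above[OF finite_family top_mem \<open>x \<in> P\<close>] two(1) by metis
    then have "covered_by P (C \<inter> D) E" using cov by auto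
    then have "\<not> x \<subset> E" using that by (simp add: covered_by_def)
    then have "x = E" using \<open>x \<subseteq> E\<close> by (simp add: psubset_eq)
    then show ?thesis using \<open>E \<in> {C, D}\<close> by simp
  qed simp
  moreover have "{m, C, D} \<subseteq> {x \<in> P. C \<inter> D < x \<and> x \<le> m}"
  proof -
    have "C \<in> P" "D \<in> P" "C \<subset> m" "D \<subset> m" "C \<inter> D \<subset> C" "C \<inter> D \<subset> D"
      using cov CD by (simp_all add: covered_by_def)
    then show ?thesis using top_mem by auto
  qed
  ultimately have "{x \<in> P. C \<inter> D < x \<and> x \<le> m} = {m, C, D}"
    by blast
  moreover have "C \<inter> D < m" using cov(1) CD(1) less_trans by (auto simp only: covered_by_def)
  moreover have "m \<noteq> C" "m \<noteq> D" using CD by (simp_all only: covered_by_def less_le) blast+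
  ultimately show ?thesis
    using moebius_eqs(1,2)[OF finite_family] moebius_coatom[OF finite_family] CD two(2) by simp
qed

end

section \<open>Intervals as sets convex in value and in position\<close>

definition order_convex :: "nat set \<Rightarrow> bool" where
  "order_convex S \<longleftrightarrow> (\<forall>x \<in> S. \<forall>z \<in> S. \<forall>y. x \<le> y \<and> y \<le> z \<longrightarrow> y \<in> S)"

lemma order_convexI:
  "(\<And>x y z. x \<in> S \<Longrightarrow> z \<in> S \<Longrightarrow> x < y \<Longrightarrow> y < z \<Longrightarrow> y \<in> S) \<Longrightarrow> order_convex S"
  unfolding order_convex_def by (metis order_le_less)

lemma order_convexD:
  "order_convex S \<Longrightarrow> x \<in> S \<Longrightarrow> z \<in> S \<Longrightarrow> x \<le> y \<Longrightarrow> y \<le> z \<Longrightarrow> y \<in> S"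
  unfolding order_convex_def by blast

lemma order_convex_Int: "order_convex A \<Longrightarrow> order_convex B \<Longrightarrow> order_convex (A \<inter> B)"
  unfolding order_convex_def by blast

lemma order_convex_Un:
  assumes "order_convex A" "order_convex B" "A \<inter> B \<noteq> {}"
  shows "order_convex (A \<union> B)"
proof (rule order_convexI)
  fix x y z assume xyz: "x \<in> A \<union> B" "z \<in> A \<union> B" "x < y" "y < z"
  obtain w where "w \<in> A" "w \<in> B" using assms(3) by auto
  then show "y \<in> A \<union> B"
    using xyz assms(1,2)[THEN order_convexD, of x _ y] assms(1,2)[THEN order_convexD, of _ z y]
    by (metis Un_iff less_imp_le nat_le_linear)
qed

text \<open>
  A convex set \<open>B\<close> that meets \<open>A\<close> and also reaches outside \<open>A\<close> cuts off an end of \<open>A\<close>; only a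
  \<open>B\<close> inside \<open>A\<close> could leave a gap.
\<close>

lemma order_convex_Diff:
  assumes "order_convex A" "order_convex B" "A \<inter> B \<noteq> {}" "\<not> B \<subseteq> A"
  shows "order_convex (A - B)"
proof (rule order_convexI)
  fix x y z assume xyz: "x \<in> A - B" "z \<in> A - B" "x < y" "y < z"
  obtain w where w: "w \<in> B" "w \<notin> A" using assms(4) by auto
  have "y \<in> A" using xyz order_convexD[OF assms(1), of x z y] by auto
  moreover have "y \<notin> B"
  proof
    assume "y \<in> B"
    show False
    proof (cases "w < y")
      case True
      then have "w < x"
        using xyz w \<open>y \<in> A\<close> order_convexD[OF assms(1), of x y w] by force
      then show False using xyz w \<open>y \<in> B\<close> order_convexD[OF assms(2), of w y x] by auto
    next
      case False
      then have "z < w"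
        using xyz w \<open>y \<in> A\<close> order_convexD[OF assms(1), of y z w] by force
      then show False using xyz w \<open>y \<in> B\<close> order_convexD[OF assms(2), of y w z] by auto
    qed
  qed
  ultimately show "y \<in> A - B" by simp
qed

lemma order_convex_eq_atLeastAtMost:
  assumes "order_convex S" "finite S" "S \<noteq> {}"
  shows "S = {Min S..Max S}"
proof
  have "Min S \<in> S" "Max S \<in> S" using assms(2,3) by simp_all
  then show "{Min S..Max S} \<subseteq> S"
    using order_convexD[OF assms(1)] by (meson atLeastAtMost_iff subsetI)
  show "S \<subseteq> {Min S..Max S}"
    using assms(2) by auto
qed

definition positions :: "nat list \<Rightarrow> nat set \<Rightarrow> nat set" where
  "positions \<sigma> J = {i. i < length \<sigma> \<and> \<sigma> ! i \<in> J}"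

lemma positions_Int: "positions \<sigma> (A \<inter> B) = positions \<sigma> A \<inter> positions \<sigma> B"
  and positions_Un: "positions \<sigma> (A \<union> B) = positions \<sigma> A \<union> positions \<sigma> B"
  and positions_Diff: "positions \<sigma> (A - B) = positions \<sigma> A - positions \<sigma> B"
  by (auto simp: positions_def)

lemma nth_image_positions:
  assumes "J \<subseteq> set \<sigma>"
  shows "(\<lambda>i. \<sigma> ! i) ` positions \<sigma> J = J"
proof
  show "J \<subseteq> (\<lambda>i. \<sigma> ! i) ` positions \<sigma> J"
  proof
    fix x assume "x \<in> J"
    then obtain i where "i < length \<sigma>" "\<sigma> ! i = x"
      using assms by (auto simp: in_set_conv_nth dest!: subsetD)
    then show "x \<in> (\<lambda>i. \<sigma> ! i) ` positions \<sigma> J"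
      using \<open>x \<in> J\<close> by (auto simp: positions_def)
  qed
qed (auto simp: positions_def)

lemma positions_subset_iff:
  assumes "A \<subseteq> set \<sigma>"
  shows "positions \<sigma> A \<subseteq> positions \<sigma> B \<longleftrightarrow> A \<subseteq> B"
proof
  assume "positions \<sigma> A \<subseteq> positions \<sigma> B"
  then have "(\<lambda>i. \<sigma> ! i) ` positions \<sigma> A \<subseteq> B" by (auto simp: positions_def)
  then show "A \<subseteq> B" using nth_image_positions[OF assms] by simp
next
  assume "A \<subseteq> B"
  then show "positions \<sigma> A \<subseteq> positions \<sigma> B" by (auto simp: positions_def)
qed

lemma positions_eq_empty_iff: "A \<subseteq> set \<sigma> \<Longrightarrow> positions \<sigma> A = {} \<longleftrightarrow> A = {}"
  using positions_subset_iff[of A \<sigma> "{}"] by (auto simp: positions_def)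

text \<open>
  In the definition of intervals the set of values and the set of positions have equal lengths;
  this is automatic because \<open>\<sigma>\<close> is injective on positions. The description by convexity treats
  values and positions alike and covers the empty interval, so the closure properties of
  convex sets carry over.
\<close>

lemma intervals_iff_order_convex:
  assumes "distinct \<sigma>"
  shows "J \<in> intervals \<sigma> \<longleftrightarrow>
    J \<subseteq> set \<sigma> \<and> order_convex J \<and> order_convex (positions \<sigma> J)"
proof (cases "J = {}")
  case True
  then show ?thesis by (simp add: intervals_def positions_def order_convex_def)
next
  case False
  show ?thesis
  proof
    assume "J \<in> intervals \<sigma>"
    then obtain i j h where ijh: "i + h < length \<sigma>" "J = {j..j + h}"
      "(\<lambda>p. \<sigma> ! p) ` {i..i + h} = J"
      using False by (auto simp: intervals_def)
    have "positions \<sigma> J = {i..i + h}"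
    proof
      show "positions \<sigma> J \<subseteq> {i..i + h}"
      proof
        fix p assume p: "p \<in> positions \<sigma> J"
        then have "\<sigma> ! p \<in> (\<lambda>p. \<sigma> ! p) ` {i..i + h}" using ijh(3) by (simp add: positions_def)
        then obtain q where "q \<in> {i..i + h}" "\<sigma> ! p = \<sigma> ! q" by auto
        then show "p \<in> {i..i + h}"
          using p ijh(1) assms by (auto simp: positions_def nth_eq_iff_index_eq)
      qed
      show "{i..i + h} \<subseteq> positions \<sigma> J" using ijh by (auto simp: positions_def)
    qed
    moreover have "J \<subseteq> set \<sigma>" using ijh(1,3) by auto
    ultimately show "J \<subseteq> set \<sigma> \<and> order_convex J \<and> order_convex (positions \<sigma> J)"
      using ijh(2) by (auto simp: order_convex_def)
  next
    assume R: "J \<subseteq> set \<sigma> \<and> order_convex J \<and> order_convex (positions \<sigma> J)"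
    define p where "p = positions \<sigma> J"
    have fin: "finite J" "finite p"
      using R finite_subset by (auto simp: p_def positions_def)
    have ne: "p \<noteq> {}" using False R by (simp add: p_def positions_eq_empty_iff)
    have J: "J = {Min J..Max J}"
      using R fin False by (intro order_convex_eq_atLeastAtMost) auto
    have P: "p = {Min p..Max p}"
      using R fin ne by (intro order_convex_eq_atLeastAtMost) (auto simp: p_def)
    have "inj_on (\<lambda>i. \<sigma> ! i) p"
      using assms by (auto simp: inj_on_def p_def positions_def nth_eq_iff_index_eq)
    then have "card p = card J"
      using nth_image_positions[of J \<sigma>] R card_image p_def by metis
    moreover have "card J = Suc (Max J) - Min J" "card p = Suc (Max p) - Min p"
      using arg_cong[OF J, of card] arg_cong[OF P, of card] by simp_all
    moreover have "Min J \<le> Max J" "Min p \<le> Max p"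
      using fin False ne by auto
    ultimately have "Max J = Min J + (Max p - Min p)" "Max p = Min p + (Max p - Min p)"
      by linarith+
    then obtain h where "Max J = Min J + h" "Max p = Min p + h"
      by blast
    moreover have "Max p < length \<sigma>"
      using Max_in[OF fin(2) ne] by (auto simp: p_def positions_def)
    moreover have "(\<lambda>i. \<sigma> ! i) ` {Min p..Max p} = J"
      using P R nth_image_positions[of J \<sigma>] p_def by metis
    ultimately show "J \<in> intervals \<sigma>"
      unfolding intervals_def using J by (metis (mono_tags, lifting) mem_Collect_eq)
  qed
qed

lemma intervals_Int:
  assumes "distinct \<sigma>" "A \<in> intervals \<sigma>" "B \<in> intervals \<sigma>"
  shows "A \<inter> B \<in> intervals \<sigma>"
  using assms by (auto simp: intervals_iff_order_convex positions_Int order_convex_Int)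

lemma intervals_Un:
  assumes "distinct \<sigma>" "A \<in> intervals \<sigma>" "B \<in> intervals \<sigma>" "A \<inter> B \<noteq> {}"
  shows "A \<union> B \<in> intervals \<sigma>"
proof -
  have "positions \<sigma> A \<inter> positions \<sigma> B \<noteq> {}"
    using assms positions_eq_empty_iff[of "A \<inter> B" \<sigma>]
    by (auto simp: intervals_iff_order_convex positions_Int)
  then show ?thesis
    using assms by (auto simp: intervals_iff_order_convex positions_Un order_convex_Un)
qed

lemma intervals_Diff:
  assumes "distinct \<sigma>" "A \<in> intervals \<sigma>" "B \<in> intervals \<sigma>" "A \<inter> B \<noteq> {}" "\<not> B \<subseteq> A"
  shows "A - B \<in> intervals \<sigma>"
proof -
  have "positions \<sigma> A \<inter> positions \<sigma> B \<noteq> {}" "\<not> positions \<sigma> B \<subseteq> positions \<sigma> A"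
    using assms positions_eq_empty_iff[of "A \<inter> B" \<sigma>] positions_subset_iff[of B \<sigma> A]
    by (auto simp: intervals_iff_order_convex positions_Int)
  then show ?thesis
    using assms by (auto simp: intervals_iff_order_convex positions_Diff order_convex_Diff)
qed

lemma is_permD:
  assumes "is_perm n \<sigma>"
  shows "length \<sigma> = n" "set \<sigma> = {1..n}" "distinct \<sigma>" "1 \<le> n"
  using assms by (auto simp: is_perm_def permutations_of_set_def distinct_card[symmetric])

lemma positions_full: "positions \<sigma> (set \<sigma>) = {..<length \<sigma>}"
  by (auto simp: positions_def)

lemma top_mem_intervals:
  assumes "is_perm n \<sigma>"
  shows "{1..n} \<in> intervals \<sigma>"
proof -
  note p = is_permD[OF assms]
  have "positions \<sigma> {1..n} = {..<n}"
    using positions_full[of \<sigma>] p by simp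
  then show ?thesis
    using p by (simp add: intervals_iff_order_convex order_convex_def)
qed

lemma intersection_family_intervals:
  assumes "is_perm n \<sigma>"
  shows "intersection_family (intervals \<sigma>) {1..n}"
proof
  note p = is_permD[OF assms]
  show "finite (intervals \<sigma>)" by (rule finite_intervals)
  show "{1..n} \<in> intervals \<sigma>" by (rule top_mem_intervals[OF assms])
  show "A \<subseteq> {1..n}" if "A \<in> intervals \<sigma>" for A
    using that p by (simp add: intervals_iff_order_convex)
  show "A \<inter> B \<in> intervals \<sigma>" if "A \<in> intervals \<sigma>" "B \<in> intervals \<sigma>" for A B
    using that p(3) by (intro intervals_Int)
qed

section \<open>Overlapping coatoms\<close>

lemma coatom_subset_interval:
  assumes "C \<in> coatoms (intervals \<sigma>) {1..n}" "J \<in> intervals \<sigma>" "J \<subseteq> {1..n}" "C \<subseteq> J"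
  shows "J = C \<or> J = {1..n}"
  using assms by (auto simp: coatoms_def covered_by_def)

lemma coatom_intervalD:
  assumes "C \<in> coatoms (intervals \<sigma>) {1..n}"
  shows "C \<in> intervals \<sigma>" "C \<subset> {1..n}"
  using assms by (simp_all add: coatoms_def covered_by_def)

lemma overlapping_coatoms_Un:
  assumes perm: "is_perm n \<sigma>"
    and CD: "C \<in> coatoms (intervals \<sigma>) {1..n}" "D \<in> coatoms (intervals \<sigma>) {1..n}"
    "C \<noteq> D" "C \<inter> D \<noteq> {}"
  shows "C \<union> D = {1..n}"
proof (rule ccontr)
  assume "C \<union> D \<noteq> {1..n}"
  moreover have "C \<union> D \<in> intervals \<sigma>"
    by (intro intervals_Un is_permD(3)[OF perm] coatom_intervalD(1)[OF CD(1)]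
        coatom_intervalD(1)[OF CD(2)] CD(4))
  moreover have "C \<union> D \<subseteq> {1..n}"
    using coatom_intervalD(2)[OF CD(1)] coatom_intervalD(2)[OF CD(2)] by blast
  ultimately have "C \<union> D = C" "C \<union> D = D"
    using coatom_subset_interval[OF CD(1)] coatom_subset_interval[OF CD(2)] by blast+
  then show False using CD(3) by simp
qed

text \<open>
  Two overlapping coatoms have an interval as union, hence cover \<open>{1..n}\<close>, and a coatom disjoint
  from one of them would lie inside the other. So any two of three coatoms would cover
  \<open>{1..n}\<close>: the value \<open>1\<close> is missing from at most one of the three, and so is \<open>n\<close>. Then one of
  them contains both, and by convexity it is everything.
\<close>

lemma overlapping_coatoms_unique:
  assumes perm: "is_perm n \<sigma>"
    and CD: "C \<in> coatoms (intervals \<sigma>) {1..n}" "D \<in> coatoms (intervals \<sigma>) {1..n}"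
    "C \<noteq> D" "C \<inter> D \<noteq> {}"
  shows "coatoms (intervals \<sigma>) {1..n} = {C, D}"
proof (rule ccontr)
  let ?m = "{1..n}"
  assume "coatoms (intervals \<sigma>) ?m \<noteq> {C, D}"
  then obtain E where E: "E \<in> coatoms (intervals \<sigma>) ?m" "E \<noteq> C" "E \<noteq> D"
    using CD by blast
  have not_both: "1 \<notin> X \<or> n \<notin> X" if "X \<in> coatoms (intervals \<sigma>) ?m" for X
  proof (rule ccontr)
    assume "\<not> (1 \<notin> X \<or> n \<notin> X)"
    moreover have "order_convex X"
      using coatom_intervalD(1)[OF that] is_permD(3)[OF perm]
      by (simp add: intervals_iff_order_convex)
    ultimately have "?m \<subseteq> X"
      using order_convexD[of X 1 n] by auto
    then show False using coatom_intervalD(2)[OF that] by auto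
  qed
  have CD_Un: "C \<union> D = ?m" by (rule overlapping_coatoms_Un[OF perm CD])
  have incomparable: "\<not> E \<subseteq> C" "\<not> E \<subseteq> D"
    using coatom_subset_interval[OF E(1)] coatom_intervalD[OF CD(1)] coatom_intervalD[OF CD(2)] E
    by blast+
  then have "E \<inter> C \<noteq> {}" "E \<inter> D \<noteq> {}"
    using CD_Un coatom_intervalD(2)[OF E(1)] by blast+
  then have "E \<union> C = ?m" "E \<union> D = ?m"
    using overlapping_coatoms_Un[OF perm E(1)] CD E by blast+
  moreover have "1 \<in> ?m" "n \<in> ?m" using is_permD(4)[OF perm] by auto
  ultimately have "1 \<in> C \<union> D" "1 \<in> E \<union> C" "1 \<in> E \<union> D" "n \<in> C \<union> D" "n \<in> E \<union> C" "n \<in> E \<union> D"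
    using CD_Un by blast+
  then show False
    using not_both[OF CD(1)] not_both[OF CD(2)] not_both[OF E(1)] by blast
qed

text \<open>
  An interval strictly between \<open>C \<inter> D\<close> and \<open>C\<close> overlaps \<open>D\<close> without being contained in it, so
  together with \<open>D\<close> it covers everything; hence it contains \<open>C - D\<close>.
\<close>

lemma covered_by_Int_overlapping_coatoms:
  assumes perm: "is_perm n \<sigma>"
    and CD: "C \<in> coatoms (intervals \<sigma>) {1..n}" "D \<in> coatoms (intervals \<sigma>) {1..n}"
    "C \<noteq> D" "C \<inter> D \<noteq> {}"
  shows "covered_by (intervals \<sigma>) (C \<inter> D) C"
proof -
  note C = coatom_intervalD[OF CD(1)] and D = coatom_intervalD[OF CD(2)]
  note dist = is_permD(3)[OF perm]
  have "False" if J: "J \<in> intervals \<sigma>" "C \<inter> D \<subset> J" "J \<subset> C" for J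
  proof -
    have "J \<union> D \<in> intervals \<sigma>"
      using J(2) CD(4) by (intro intervals_Un dist J(1) D(1)) auto
    then have "J \<union> D = D \<or> J \<union> D = {1..n}"
      using C D J by (intro coatom_subset_interval[OF CD(2)]) auto
    then show False using J C(2) by blast
  qed
  moreover have "\<not> C \<subseteq> D"
    using coatom_subset_interval[OF CD(1) D(1)] D(2) CD(3) by blast
  moreover have "C \<inter> D \<in> intervals \<sigma>"
    using C D by (intro intervals_Int dist)
  ultimately show ?thesis
    using C(1) unfolding covered_by_def by blast
qed

section \<open>The blocks of an inflation\<close>

text \<open>
  What an inflation \<open>\<pi>[\<alpha>(1), \<dots>, \<alpha>(k)]\<close> says about the sets of values of its blocks, without
  reference to the patterns inside the blocks. The order of the blocks in position is that of
  their indices, their order in value is that of the letters of \<open>\<pi>\<close>.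
\<close>

locale block_decomposition =
  fixes \<sigma> \<pi> :: "nat list" and n k :: nat and B :: "nat \<Rightarrow> nat set"
  assumes perm_\<sigma>: "is_perm n \<sigma>"
    and perm_\<pi>: "is_perm k \<pi>"
    and block_interval: "i < k \<Longrightarrow> B i \<in> intervals \<sigma>"
    and block_nonempty: "i < k \<Longrightarrow> B i \<noteq> {}"
    and UN_blocks: "(\<Union>i<k. B i) = {1..n}"
    and block_positions_less:
      "i < j \<Longrightarrow> j < k \<Longrightarrow> p \<in> positions \<sigma> (B i) \<Longrightarrow> q \<in> positions \<sigma> (B j) \<Longrightarrow> p < q"
    and block_values_less:
      "i < k \<Longrightarrow> j < k \<Longrightarrow> \<pi> ! i < \<pi> ! j \<Longrightarrow> x \<in> B i \<Longrightarrow> y \<in> B j \<Longrightarrow> x < y"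
begin

lemmas \<sigma>_facts = is_permD[OF perm_\<sigma>]
lemmas \<pi>_facts = is_permD[OF perm_\<pi>]

lemma nth_\<pi>_eq_iff: "i < k \<Longrightarrow> j < k \<Longrightarrow> \<pi> ! i = \<pi> ! j \<longleftrightarrow> i = j"
  using \<pi>_facts by (simp add: nth_eq_iff_index_eq)

lemma obtain_\<pi>_index:
  assumes "v \<in> {1..k}"
  obtains i where "i < k" "\<pi> ! i = v"
  using assms \<pi>_facts by (metis in_set_conv_nth)

lemma block_subset: "i < k \<Longrightarrow> B i \<subseteq> {1..n}"
  using UN_blocks by auto

lemma block_eqI:
  assumes "i < k" "j < k" "x \<in> B i" "x \<in> B j"
  shows "i = j"
proof (rule ccontr)
  assume "i \<noteq> j"
  then have "\<pi> ! i < \<pi> ! j \<or> \<pi> ! j < \<pi> ! i"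
    using nth_\<pi>_eq_iff[OF assms(1,2)] by linarith
  then show False
    using block_values_less[of i j x x] block_values_less[of j i x x] assms by auto
qed

lemma obtain_block:
  assumes "x \<in> {1..n}"
  obtains i where "i < k" "x \<in> B i"
  using assms unfolding UN_blocks[symmetric] by auto

lemma obtain_block_position:
  assumes "i < k" "x \<in> B i"
  obtains p where "p \<in> positions \<sigma> (B i)" "\<sigma> ! p = x"
proof -
  have "B i \<subseteq> set \<sigma>" using block_subset[OF assms(1)] \<sigma>_facts by simp
  then have "x \<in> (\<lambda>p. \<sigma> ! p) ` positions \<sigma> (B i)"
    using nth_image_positions assms(2) by simp
  then show thesis using that by auto
qed

definition met_blocks :: "nat set \<Rightarrow> nat set" where
  "met_blocks J = {i. i < k \<and> B i \<inter> J \<noteq> {}}"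

lemma positions_image_index_set:
  assumes "S \<subseteq> {..<k}"
  shows "positions \<pi> ((\<lambda>i. \<pi> ! i) ` S) = S"
  using assms \<pi>_facts by (auto simp: positions_def nth_\<pi>_eq_iff subset_iff)

text \<open>
  If an interval meets two blocks, it contains every block lying between them, be it in position
  or in value.
\<close>

lemma met_blocks_interval:
  assumes "J \<in> intervals \<sigma>"
  shows "(\<lambda>i. \<pi> ! i) ` met_blocks J \<in> intervals \<pi>"
proof -
  let ?T = "(\<lambda>i. \<pi> ! i) ` met_blocks J"
  have J: "order_convex J" "order_convex (positions \<sigma> J)"
    using assms \<sigma>_facts by (simp_all add: intervals_iff_order_convex)
  have sub: "met_blocks J \<subseteq> {..<k}" by (auto simp: met_blocks_def)
  have T: "?T \<subseteq> set \<pi>" using sub \<pi>_facts(1) by (auto simp: subset_iff)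
  have "order_convex ?T"
  proof (rule order_convexI)
    fix u v w assume uw: "u \<in> ?T" "w \<in> ?T" "u < v" "v < w"
    obtain i x where i: "i < k" "\<pi> ! i = u" "x \<in> B i" "x \<in> J"
      using uw(1) by (auto simp: met_blocks_def)
    obtain l z where l: "l < k" "\<pi> ! l = w" "z \<in> B l" "z \<in> J"
      using uw(2) by (auto simp: met_blocks_def)
    have "u \<in> {1..k}" "w \<in> {1..k}" using uw(1,2) T \<pi>_facts by auto
    then have "v \<in> {1..k}" using uw(3,4) by auto
    then obtain j where j: "j < k" "\<pi> ! j = v" by (rule obtain_\<pi>_index)
    obtain y where y: "y \<in> B j" using block_nonempty[OF j(1)] by auto
    have "x < y" "y < z"
      using block_values_less[of i j x y] block_values_less[of j l y z] i j l y uw(3,4) by auto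
    then have "y \<in> J" using order_convexD[OF J(1) i(4) l(4)] by auto
    then have "j \<in> met_blocks J" using j y by (auto simp: met_blocks_def)
    then show "v \<in> ?T" using j by auto
  qed
  moreover have "order_convex (met_blocks J)"
  proof (rule order_convexI)
    fix i j l assume il: "i \<in> met_blocks J" "l \<in> met_blocks J" "i < j" "j < l"
    obtain x where x: "i < k" "x \<in> B i" "x \<in> J"
      using il(1) by (auto simp: met_blocks_def)
    obtain z where z: "l < k" "z \<in> B l" "z \<in> J"
      using il(2) by (auto simp: met_blocks_def)
    have j: "j < k" using il z by simp
    obtain y where y: "y \<in> B j" using block_nonempty[OF j] by auto
    obtain p where p: "p \<in> positions \<sigma> (B i)" "\<sigma> ! p = x"
      using obtain_block_position[OF x(1,2)] .
    obtain q where q: "q \<in> positions \<sigma> (B j)" "\<sigma> ! q = y"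
      using obtain_block_position[OF j y] .
    obtain r where r: "r \<in> positions \<sigma> (B l)" "\<sigma> ! r = z"
      using obtain_block_position[OF z(1,2)] .
    have "p < q" "q < r" using block_positions_less il j z(1) p(1) q(1) r(1) by blast+
    moreover have "p \<in> positions \<sigma> J" "r \<in> positions \<sigma> J"
      using p r x z by (auto simp: positions_def)
    ultimately have "q \<in> positions \<sigma> J"
      using order_convexD[OF J(2)] by (meson less_imp_le)
    then show "j \<in> met_blocks J"
      using q j y by (auto simp: met_blocks_def positions_def)
  qed
  ultimately show ?thesis
    using T \<pi>_facts by (simp add: intervals_iff_order_convex positions_image_index_set[OF sub])
qed

text \<open>
  Conversely, intervals of \<open>\<pi>\<close> lift: an element lying between two blocks in position or in value
  belongs to a block lying between them or equal to one of them.
\<close>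

lemma UN_blocks_interval:
  assumes "T \<in> intervals \<pi>"
  shows "(\<Union>i \<in> positions \<pi> T. B i) \<in> intervals \<sigma>"
proof -
  let ?S = "positions \<pi> T" let ?J = "\<Union>i \<in> ?S. B i"
  have T: "order_convex T" "order_convex ?S"
    using assms \<pi>_facts by (simp_all add: intervals_iff_order_convex)
  have S: "i \<in> ?S \<longleftrightarrow> i < k \<and> \<pi> ! i \<in> T" for i
    using \<pi>_facts by (simp add: positions_def)
  have sub: "?J \<subseteq> {1..n}" using S block_subset by blast
  have "order_convex ?J"
  proof (rule order_convexI)
    fix x y z assume xz: "x \<in> ?J" "z \<in> ?J" "x < y" "y < z"
    obtain i l where i: "i \<in> ?S" "x \<in> B i" and l: "l \<in> ?S" "z \<in> B l" using xz by auto
    have "y \<in> {1..n}" using xz sub by force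
    then obtain j where j: "j < k" "y \<in> B j" by (rule obtain_block)
    have "\<not> \<pi> ! j < \<pi> ! i" "\<not> \<pi> ! l < \<pi> ! j"
      using block_values_less[of j i y x] block_values_less[of l j z y] S i l j xz(3,4) by auto
    then have "\<pi> ! j \<in> T" using order_convexD[OF T(1), of "\<pi> ! i" "\<pi> ! l"] S i l by auto
    then show "y \<in> ?J" using S j by auto
  qed
  moreover have "order_convex (positions \<sigma> ?J)"
  proof (rule order_convexI)
    fix p q r assume pr: "p \<in> positions \<sigma> ?J" "r \<in> positions \<sigma> ?J" "p < q" "q < r"
    obtain i l where i: "i \<in> ?S" "p \<in> positions \<sigma> (B i)" and l: "l \<in> ?S" "r \<in> positions \<sigma> (B l)"
      using pr by (auto simp: positions_def)
    have q: "q < length \<sigma>" using pr by (auto simp: positions_def)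
    then have "\<sigma> ! q \<in> {1..n}" using nth_mem \<sigma>_facts by blast
    then obtain j where j: "j < k" "\<sigma> ! q \<in> B j" by (rule obtain_block)
    then have qj: "q \<in> positions \<sigma> (B j)" using q by (simp add: positions_def)
    have "\<not> j < i" "\<not> l < j"
      using block_positions_less[of j i q p] block_positions_less[of l j r q] S i l j(1) qj pr(3,4)
      by auto
    then have "j \<in> ?S" using order_convexD[OF T(2), of i l] i l by auto
    then show "q \<in> positions \<sigma> ?J" using qj by (auto simp: positions_def)
  qed
  ultimately show ?thesis
    using sub \<sigma>_facts by (simp add: intervals_iff_order_convex)
qed

text \<open>
  By assumption a coatom lies in a block, which is itself a proper interval, hence equals it; a
  proper interval strictly above a block would lie in another block, but blocks are disjoint.
\<close>

lemma coatoms_eq_blocks: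
  assumes proper: "\<And>J. J \<in> intervals \<sigma> \<Longrightarrow> J \<noteq> {1..n} \<Longrightarrow> \<exists>i<k. J \<subseteq> B i"
    and "2 \<le> k"
  shows "coatoms (intervals \<sigma>) {1..n} = B ` {..<k}"
proof -
  have block_ne_top: "B i \<noteq> {1..n}" if "i < k" for i
  proof
    assume eq: "B i = {1..n}"
    obtain j where j: "j < k" "j \<noteq> i" using \<open>2 \<le> k\<close> that[of "if i = 0 then 1 else 0"] by auto
    obtain x where "x \<in> B j" using block_nonempty[OF j(1)] by auto
    then show False using block_eqI[OF j(1) that, of x] block_subset[OF j(1)] eq j by auto
  qed
  have top: "{1..n} \<in> intervals \<sigma>" by (rule top_mem_intervals[OF perm_\<sigma>])
  show ?thesis
  proof
    show "coatoms (intervals \<sigma>) {1..n} \<subseteq> B ` {..<k}"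
    proof
      fix C assume C: "C \<in> coatoms (intervals \<sigma>) {1..n}"
      then obtain i where i: "i < k" "C \<subseteq> B i"
        using proper coatom_intervalD[OF C] by blast
      then have "B i = C"
        using coatom_subset_interval[OF C block_interval block_subset] block_ne_top by blast
      then show "C \<in> B ` {..<k}" using i by auto
    qed
    show "B ` {..<k} \<subseteq> coatoms (intervals \<sigma>) {1..n}"
    proof
      fix C assume "C \<in> B ` {..<k}"
      then obtain i where i: "i < k" "C = B i" by auto
      have "False" if J: "J \<in> intervals \<sigma>" "B i \<subset> J" "J \<subset> {1..n}" for J
      proof -
        obtain j where j: "j < k" "J \<subseteq> B j" using proper J by blast
        obtain x where x: "x \<in> B i" using block_nonempty[OF i(1)] by auto
        then have "i = j" using j J(2) by (intro block_eqI[OF i(1) j(1), of x]) auto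
        then show False using J(2) j(2) by auto
      qed
      moreover have "B i \<subset> {1..n}"
        using block_subset[OF i(1)] block_ne_top[OF i(1)] by auto
      ultimately have "covered_by (intervals \<sigma>) (B i) {1..n}"
        using block_interval[OF i(1)] top unfolding covered_by_def by blast
      then show "C \<in> coatoms (intervals \<sigma>) {1..n}" using i by (simp add: coatoms_def)
    qed
  qed
qed

lemma block_inj_on: "inj_on B {..<k}"
proof (rule inj_onI)
  fix i j assume ij: "i \<in> {..<k}" "j \<in> {..<k}" "B i = B j"
  obtain x where "x \<in> B i" using block_nonempty[of i] ij by auto
  then show "i = j" using ij block_eqI[of i j x] by auto
qed

text \<open>
  Let \<open>J\<close> be an interval meeting two blocks. By simplicity it meets all blocks. If it misses a
  point of the block \<open>B i\<close>, then \<open>J - B i\<close> is an interval, and the blocks that it meets, all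
  except \<open>B i\<close>, correspond to a proper interval of \<open>\<pi>\<close> with at least three elements.
\<close>

lemma proper_interval_subset_block_simple:
  assumes simple: "simple_perm \<pi>" and J: "J \<in> intervals \<sigma>" "J \<noteq> {1..n}"
  shows "\<exists>i<k. J \<subseteq> B i"
proof (rule ccontr)
  assume not_sub: "\<not> (\<exists>i<k. J \<subseteq> B i)"
  have k: "4 \<le> k" and trivial: "\<And>T. T \<in> intervals \<pi> \<Longrightarrow> T \<noteq> {} \<Longrightarrow> is_singleton T \<or> T = {1..k}"
    using simple \<pi>_facts by (auto simp: simple_perm_def)
  have card_image: "card ((\<lambda>i. \<pi> ! i) ` S) = card S" if "S \<subseteq> {..<k}" for S
    using that nth_\<pi>_eq_iff by (intro card_image inj_onI) (auto simp: subset_iff)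
  have met_sub: "met_blocks X \<subseteq> {..<k}" for X by (auto simp: met_blocks_def)
  have met_card: "card (met_blocks X) \<le> 1 \<or> card (met_blocks X) = k" if "X \<in> intervals \<sigma>" for X
    using trivial[OF met_blocks_interval[OF that]] card_image[OF met_sub, of X]
    by (cases "met_blocks X = {}") (auto simp: is_singleton_altdef)
  have J_sub: "J \<subseteq> {1..n}" using J(1) \<sigma>_facts by (simp add: intervals_iff_order_convex)
  have "J \<noteq> {}" using not_sub k by (auto dest: spec[of _ 0])
  then obtain x where x: "x \<in> J" by auto
  then obtain i where i: "i < k" "x \<in> B i" using J_sub obtain_block by blast
  obtain y where y: "y \<in> J" "y \<notin> B i" using not_sub i by auto
  then obtain j where j: "j < k" "y \<in> B j" using J_sub obtain_block by blast
  have "finite (met_blocks J)" by (rule finite_subset[OF met_sub]) simp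
  moreover have "{i, j} \<subseteq> met_blocks J" using i j x y by (auto simp: met_blocks_def)
  ultimately have "card {i, j} \<le> card (met_blocks J)" by (rule card_mono)
  moreover have "i \<noteq> j" using y(2) j(2) by auto
  then have "card {i, j} = 2" by simp
  ultimately have "card (met_blocks J) = k" using met_card[OF J(1)] by linarith
  then have "met_blocks J = {..<k}" by (intro card_subset_eq met_sub) simp_all
  then have meets: "B i \<inter> J \<noteq> {}" if "i < k" for i
    using that unfolding met_blocks_def by blast
  obtain z where z: "z \<in> {1..n}" "z \<notin> J" using J(2) J_sub by blast
  then obtain l where l: "l < k" "z \<in> B l" using obtain_block by blast
  have "B l \<inter> J \<noteq> {}" "\<not> B l \<subseteq> J" using meets[OF l(1)] z l by blast+
  then have "J - B l \<in> intervals \<sigma>"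
    using intervals_Diff[OF \<sigma>_facts(3) J(1) block_interval[OF l(1)]] by (simp add: Int_commute)
  moreover have "B i \<inter> (J - B l) \<noteq> {}" if "i < k" "i \<noteq> l" for i
    using meets[OF that(1)] block_eqI[OF that(1) l(1)] that(2) by blast
  then have "met_blocks (J - B l) = {..<k} - {l}"
    unfolding met_blocks_def by blast
  then have "card (met_blocks (J - B l)) = k - 1" using l(1) by simp
  ultimately show False using met_card[of "J - B l"] k by linarith
qed

text \<open>
  By assumption all blocks but the first form an interval of \<open>\<sigma>\<close>, and so do all blocks but the
  last. These two proper intervals share the second block, and together they are everything. So a coatom above one and a coatom
  above the other overlap and are different.
\<close>

lemma overlapping_coatoms_exist:
  assumes "3 \<le> k" and "{1..k} - {\<pi> ! 0} \<in> intervals \<pi>" "{1..k} - {\<pi> ! (k - 1)} \<in> intervals \<pi>"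
  obtains C D where "C \<in> coatoms (intervals \<sigma>) {1..n}" "D \<in> coatoms (intervals \<sigma>) {1..n}"
    "C \<noteq> D" "C \<inter> D \<noteq> {}"
proof -
  have *: "\<exists>C \<in> coatoms (intervals \<sigma>) {1..n}. \<forall>i<k. i \<noteq> j \<longrightarrow> B i \<subseteq> C"
    if j: "j < k" and "{1..k} - {\<pi> ! j} \<in> intervals \<pi>" for j
  proof -
    let ?U = "\<Union>i \<in> {..<k} - {j}. B i"
    have "positions \<pi> ({1..k} - {\<pi> ! j}) = {..<k} - {j}"
      using \<pi>_facts j nth_\<pi>_eq_iff nth_mem[of _ \<pi>] by (auto simp: positions_def)
    then have U: "?U \<in> intervals \<sigma>"
      using UN_blocks_interval[OF that(2)] by simp
    obtain x where "x \<in> B j" using block_nonempty[OF j] by auto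
    then have "x \<in> {1..n} - ?U" using block_subset[OF j] block_eqI[OF j] by blast
    moreover have "?U \<subseteq> {1..n}" using block_subset by blast
    ultimately have "?U < {1..n}" by blast
    then obtain C where "C \<in> coatoms (intervals \<sigma>) {1..n}" "?U \<subseteq> C"
      using exists_coatom_above[OF finite_intervals top_mem_intervals[OF perm_\<sigma>] U] by metis
    then show ?thesis by blast
  qed
  have k: "0 < k" "1 < k" "k - 1 < k" "k - 1 \<noteq> 0" "k - 1 \<noteq> 1" using assms(1) by auto
  obtain C where C: "C \<in> coatoms (intervals \<sigma>) {1..n}" "\<forall>i<k. i \<noteq> 0 \<longrightarrow> B i \<subseteq> C"
    using *[OF k(1)] assms(2) by auto
  obtain D where D: "D \<in> coatoms (intervals \<sigma>) {1..n}" "\<forall>i<k. i \<noteq> k - 1 \<longrightarrow> B i \<subseteq> D"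
    using *[OF k(3)] assms(3) by auto
  have "B 1 \<subseteq> C \<inter> D" using C(2) D(2) k by auto
  then have "C \<inter> D \<noteq> {}" using block_nonempty[OF k(2)] by auto
  moreover have "C \<noteq> D"
  proof
    assume "C = D"
    then have "B i \<subseteq> C" if "i < k" for i
      using that C(2) D(2) k(4) by (cases "i = 0") auto
    then have "{1..n} \<subseteq> C" using UN_blocks by blast
    then show False using coatom_intervalD(2)[OF C(1)] by auto
  qed
  ultimately show thesis using that C(1) D(1) by blast
qed

end

lemma concat_position_less:
  assumes "distinct (concat Bs)" "i < j" "j < length Bs"
    "p \<in> positions (concat Bs) (set (Bs ! i))" "q \<in> positions (concat Bs) (set (Bs ! j))"
  shows "p < q"
proof -
  define xs ys where "xs = concat (take j Bs)" and "ys = concat (drop j Bs)"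
  have c: "concat Bs = xs @ ys"
    unfolding xs_def ys_def by (metis append_take_drop_id concat_append)
  have "Bs ! i \<in> set (take j Bs)" "Bs ! j \<in> set (drop j Bs)"
    using assms(2,3) nth_mem[of i "take j Bs"] nth_mem[of 0 "drop j Bs"] by simp_all
  then have "set (Bs ! i) \<subseteq> set xs" "set (Bs ! j) \<subseteq> set ys"
    unfolding xs_def ys_def by auto
  then have p: "(xs @ ys) ! p \<in> set xs" "p < length (xs @ ys)"
    and q: "(xs @ ys) ! q \<in> set ys" "q < length (xs @ ys)"
    using assms(4,5) by (auto simp add: positions_def c simp del: nth_append)
  have disj: "set xs \<inter> set ys = {}" using assms(1) c by simp
  have "p < length xs"
  proof (rule ccontr)
    assume "\<not> p < length xs"
    then have "(xs @ ys) ! p \<in> set ys" using p(2) by (simp add: nth_append)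
    then show False using p disj by auto
  qed
  moreover have "\<not> q < length xs"
  proof
    assume "q < length xs"
    then have "(xs @ ys) ! q \<in> set xs" by (simp add: nth_append)
    then show False using q disj by auto
  qed
  ultimately show ?thesis by simp
qed

lemma block_decomposition_concat:
  assumes \<sigma>: "is_perm n \<sigma>" and \<pi>: "is_perm k \<pi>" and Bs: "length Bs = k" "concat Bs = \<sigma>"
    and block: "\<And>i. i < k \<Longrightarrow> set (Bs ! i) \<in> intervals \<sigma>" "\<And>i. i < k \<Longrightarrow> Bs ! i \<noteq> []"
    and vals: "\<And>i j x y. i < k \<Longrightarrow> j < k \<Longrightarrow> \<pi> ! i < \<pi> ! j \<Longrightarrow> x \<in> set (Bs ! i) \<Longrightarrow>
      y \<in> set (Bs ! j) \<Longrightarrow> x < y"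
  shows "block_decomposition \<sigma> \<pi> n k (\<lambda>i. set (Bs ! i))"
proof
  have "set Bs = (!) Bs ` {..<k}"
    using Bs(1) by (auto simp: set_conv_nth)
  then have "(\<Union>i<k. set (Bs ! i)) = set (concat Bs)" by simp
  then show "(\<Union>i<k. set (Bs ! i)) = {1..n}"
    using Bs(2) is_permD(2)[OF \<sigma>] by simp
  show "p < q" if "i < j" "j < k" "p \<in> positions \<sigma> (set (Bs ! i))"
    "q \<in> positions \<sigma> (set (Bs ! j))" for i j p q
    using concat_position_less[of Bs i j p q] that Bs(1,2) is_permD(3)[OF \<sigma>] by simp
  show "set (Bs ! i) \<noteq> {}" if "i < k" for i using block(2)[OF that] by simp
qed (fact \<sigma> \<pi> block(1) vals)+

section \<open>Sums of two indecomposable permutations\<close>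

lemma ex_standardization:
  assumes "distinct xs" "xs \<noteq> []"
  obtains \<beta> where "is_perm (length \<beta>) \<beta>" "order_isomorphic xs \<beta>"
proof
  \<comment> \<open>Replace each letter by its rank among the letters of the word.\<close>
  define rank where "rank x = card {y \<in> set xs. y \<le> x}" for x
  let ?\<beta> = "map rank xs"
  have rank_less: "rank x < rank y" if "x < y" "y \<in> set xs" for x y
    unfolding rank_def
  proof (rule psubset_card_mono)
    have "y \<in> {z \<in> set xs. z \<le> y} - {z \<in> set xs. z \<le> x}" using that by auto
    then show "{z \<in> set xs. z \<le> x} \<subset> {z \<in> set xs. z \<le> y}" using that(1) by fastforce
  qed simp
  have rank_less_iff: "rank x < rank y \<longleftrightarrow> x < y" if "x \<in> set xs" "y \<in> set xs" for x y
    using rank_less[of x y] rank_less[of y x] that by (cases x y rule: linorder_cases) auto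
  show "order_isomorphic xs ?\<beta>"
    by (simp add: order_isomorphic_def rank_less_iff)
  have "inj_on rank (set xs)"
    by (rule inj_onI) (metis rank_less_iff less_irrefl linorder_neqE_nat)
  then have "distinct ?\<beta>" using assms(1) by (simp add: distinct_map)
  moreover have "rank x \<in> {1..length xs}" if "x \<in> set xs" for x
  proof -
    have "card {x} \<le> rank x" unfolding rank_def using that by (intro card_mono) auto
    moreover have "rank x \<le> card (set xs)" unfolding rank_def by (intro card_mono) auto
    ultimately show ?thesis using card_length[of xs] by simp
  qed
  then have "set ?\<beta> \<subseteq> {1..length xs}" by auto
  ultimately have "set ?\<beta> = {1..length ?\<beta>}"
    using distinct_card[of ?\<beta>] by (intro card_subset_eq) auto
  then show "is_perm (length ?\<beta>) ?\<beta>"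
    using \<open>distinct ?\<beta>\<close> assms(2) by (simp add: is_perm_def permutations_of_set_def Suc_le_eq)
qed

lemma order_convex_of_uniform_split:
  assumes "D \<union> E = {a..b}" "D \<inter> E = {}" "\<And>x y. x \<in> D \<Longrightarrow> y \<in> E \<Longrightarrow> x < y \<longleftrightarrow> up"
  shows "order_convex D \<and> order_convex E"
proof (intro conjI order_convexI)
  have mem: "y \<in> D \<or> y \<in> E" if "x \<in> D \<union> E" "z \<in> D \<union> E" "x < y" "y < z" for x y z
  proof -
    have "y \<in> D \<union> E" using that unfolding assms(1) by simp
    then show ?thesis by blast
  qed
  show "y \<in> D" if "x \<in> D" "z \<in> D" "x < y" "y < z" for x y z
    using mem[of x z y] assms(3)[of x y] assms(3)[of z y] that by auto
  show "y \<in> E" if "x \<in> E" "z \<in> E" "x < y" "y < z" for x y z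
    using mem[of x z y] assms(3)[of y x] assms(3)[of y z] that by auto
qed

text \<open>
  If the comparison of a letter of a prefix with a letter of the remaining suffix always has the
  same outcome, then the prefix and the suffix are intervals, and their standardizations are the
  two summands.
\<close>

lemma inflation_of_two:
  assumes \<rho>: "is_perm 2 \<rho>" and \<alpha>: "is_perm (length \<alpha>) \<alpha>" and p: "0 < p" "p < length \<alpha>"
    and split: "\<And>x y. x \<in> set (take p \<alpha>) \<Longrightarrow> y \<in> set (drop p \<alpha>) \<Longrightarrow> x < y \<longleftrightarrow> \<rho> ! 0 < \<rho> ! 1"
  obtains \<beta>s where "is_inflation \<rho> \<beta>s \<alpha>"
proof -
  let ?D = "set (take p \<alpha>)" and ?E = "set (drop p \<alpha>)"
  note f = is_permD[OF \<alpha>] and r = is_permD[OF \<rho>]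
  have DE: "?D \<union> ?E = set \<alpha>" by (metis append_take_drop_id set_append)
  have disj: "?D \<inter> ?E = {}" using f(3) by (metis append_take_drop_id distinct_append)
  have posD: "positions \<alpha> ?D = {..<p}" and posE: "positions \<alpha> ?E = {p..<length \<alpha>}"
  proof -
    have "\<alpha> ! i \<in> ?D" if "i < p" for i
      using that p by (auto simp: in_set_conv_nth intro!: exI[of _ i])
    moreover have "\<alpha> ! i \<in> ?E" if "p \<le> i" "i < length \<alpha>" for i
      using that by (auto simp: in_set_conv_nth intro!: exI[of _ "i - p"])
    moreover have "x \<notin> ?E" if "x \<in> ?D" for x using disj that by blast
    ultimately have "\<alpha> ! i \<in> ?D \<longleftrightarrow> i < p" "\<alpha> ! i \<in> ?E \<longleftrightarrow> p \<le> i" if "i < length \<alpha>" for i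
      using that by (meson linorder_not_less)+
    then show "positions \<alpha> ?D = {..<p}" "positions \<alpha> ?E = {p..<length \<alpha>}"
      using p(2) by (auto simp: positions_def)
  qed
  have "order_convex ?D \<and> order_convex ?E"
    using DE unfolding f(2) by (rule order_convex_of_uniform_split[OF _ disj split])
  moreover have "order_convex {..<p}" "order_convex {p..<length \<alpha>}"
    by (auto intro: order_convexI)
  moreover have "?D \<subseteq> set \<alpha>" "?E \<subseteq> set \<alpha>"
    using DE by blast+
  ultimately have D: "?D \<in> intervals \<alpha>" and E: "?E \<in> intervals \<alpha>"
    using f(3) posD posE by (simp_all add: intervals_iff_order_convex)
  obtain \<beta> where \<beta>: "is_perm (length \<beta>) \<beta>" "order_isomorphic (take p \<alpha>) \<beta>"
  proof (rule ex_standardization[of "take p \<alpha>"])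
    show "take p \<alpha> \<noteq> []" using p by auto
  qed (use f(3) in simp_all)
  obtain \<gamma> where \<gamma>: "is_perm (length \<gamma>) \<gamma>" "order_isomorphic (drop p \<alpha>) \<gamma>"
  proof (rule ex_standardization[of "drop p \<alpha>"])
    show "drop p \<alpha> \<noteq> []" using p by auto
  qed (use f(3) in simp_all)
  have less: "y < x" if "\<not> \<rho> ! 0 < \<rho> ! 1" "x \<in> ?D" "y \<in> ?E" for x y
  proof -
    have "x \<noteq> y" using that disj by blast
    then show ?thesis using split[OF that(2,3)] that(1) by linarith
  qed
  let ?Bs = "[take p \<alpha>, drop p \<alpha>]"
  have ordered: "\<forall>x \<in> set (?Bs ! i). \<forall>y \<in> set (?Bs ! j). x > y"
    if "i < 2" "j < 2" "\<rho> ! i > \<rho> ! j" for i j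
  proof -
    have "i = 0 \<and> j = 1 \<or> i = 1 \<and> j = 0"
      using that by (auto simp: less_2_cases_iff)
    then show ?thesis
    proof (elim disjE conjE)
      assume "i = 0" "j = 1"
      then show ?thesis using less that(3) by simp
    next
      assume "i = 1" "j = 0"
      then show ?thesis using split that(3) by simp
    qed
  qed
  have blocks: "set (?Bs ! i) \<in> intervals \<alpha> \<and> order_isomorphic (?Bs ! i) ([\<beta>, \<gamma>] ! i)"
    if "i < 2" for i
    using that D E \<beta>(2) \<gamma>(2) by (auto simp: less_2_cases_iff)
  have Bs: "\<exists>Bs. length Bs = length \<rho> \<and> concat Bs = \<alpha> \<and>
     (\<forall>i < length \<rho>. set (Bs ! i) \<in> intervals \<alpha> \<and> order_isomorphic (Bs ! i) ([\<beta>, \<gamma>] ! i)) \<and>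
     (\<forall>i < length \<rho>. \<forall>j < length \<rho>. \<rho> ! i > \<rho> ! j \<longrightarrow>
        (\<forall>x \<in> set (Bs ! i). \<forall>y \<in> set (Bs ! j). x > y))"
    unfolding r(1)
  proof (intro exI[of _ ?Bs] conjI)
    show "\<forall>i<2. set (?Bs ! i) \<in> intervals \<alpha> \<and> order_isomorphic (?Bs ! i) ([\<beta>, \<gamma>] ! i)"
      using blocks by blast
    show "\<forall>i<2. \<forall>j<2. \<rho> ! i > \<rho> ! j \<longrightarrow>
        (\<forall>x \<in> set (?Bs ! i). \<forall>y \<in> set (?Bs ! j). x > y)"
      using ordered by blast
  qed simp_all
  have "is_inflation \<rho> [\<beta>, \<gamma>] \<alpha>"
    unfolding is_inflation_def
  proof (intro conjI)
    show "is_perm (length \<rho>) \<rho>" using \<rho> r(1) by simp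
    show "\<forall>\<alpha> \<in> set [\<beta>, \<gamma>]. is_perm (length \<alpha>) \<alpha>" using \<beta>(1) \<gamma>(1) by simp
    show "length [\<beta>, \<gamma>] = length \<rho>" using r(1) by simp
  qed (rule \<alpha> Bs)+
  then show thesis by (rule that)
qed

text \<open>
  A cut given by a set \<open>X\<close> of letters of a word \<open>b\<close> order-isomorphic to \<open>\<alpha>\<close>: the letters in \<open>X\<close>
  form a prefix of \<open>b\<close> because every letter in \<open>X\<close> precedes every letter outside.
\<close>

lemma inflation_of_two_by_cut:
  assumes \<rho>: "is_perm 2 \<rho>" and \<alpha>: "is_perm (length \<alpha>) \<alpha>" and iso: "order_isomorphic b \<alpha>"
    and ex: "\<exists>u<length b. b ! u \<in> X" "\<exists>v<length b. b ! v \<notin> X"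
    and cut: "\<And>u v. u < length b \<Longrightarrow> v < length b \<Longrightarrow> b ! u \<in> X \<Longrightarrow> b ! v \<notin> X \<Longrightarrow>
      u < v \<and> (b ! u < b ! v \<longleftrightarrow> \<rho> ! 0 < \<rho> ! 1)"
  obtains \<beta>s where "is_inflation \<rho> \<beta>s \<alpha>"
proof -
  define p where "p = (LEAST v. v < length b \<and> b ! v \<notin> X)"
  have p: "p < length b" "b ! p \<notin> X"
    using LeastI_ex[OF ex(2)] by (simp_all add: p_def)
  have below: "b ! u \<in> X" if "u < p" for u
    using not_less_Least[of u "\<lambda>v. v < length b \<and> b ! v \<notin> X"] that p(1) by (auto simp: p_def)
  have above: "b ! v \<notin> X" if "p \<le> v" "v < length b" for v
    using cut[of v p] p that by auto
  have "0 < p" using ex(1) above by (metis le0 neq0_conv)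
  have len: "length b = length \<alpha>" using iso by (simp add: order_isomorphic_def)
  show thesis
  proof (rule inflation_of_two[OF \<rho> \<alpha> \<open>0 < p\<close> _ _ that])
    show "p < length \<alpha>" using p len by simp
    fix x y assume "x \<in> set (take p \<alpha>)" "y \<in> set (drop p \<alpha>)"
    then obtain u v where uv: "u < p" "x = \<alpha> ! u" "v < length \<alpha> - p" "y = \<alpha> ! (p + v)"
      using p len by (auto simp: in_set_conv_nth)
    then have "p + v < length \<alpha>" by simp
    note uv = uv this
    then have "x < y \<longleftrightarrow> b ! u < b ! (p + v)"
      using iso by (auto simp: order_isomorphic_def)
    also have "\<dots> \<longleftrightarrow> \<rho> ! 0 < \<rho> ! 1"
      using cut[of u "p + v"] below[of u] above[of "p + v"] uv len by auto
    finally show "x < y \<longleftrightarrow> \<rho> ! 0 < \<rho> ! 1" .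
  qed
qed

text \<open>
  An interval that meets both blocks but misses a point of one of them cuts that block into two
  parts; the part inside the interval is the one next to the other block, in position and in
  value. So the cut block is itself decomposable in the same direction.
\<close>

lemma proper_interval_subset_block_two:
  assumes blocks: "block_decomposition \<sigma> \<pi> n 2 (\<lambda>i. set (Bs ! i))"
    and Bs: "length Bs = 2" "concat Bs = \<sigma>"
    and \<alpha>s: "\<And>i. i < 2 \<Longrightarrow> is_perm (length (\<alpha>s ! i)) (\<alpha>s ! i) \<and> order_isomorphic (Bs ! i) (\<alpha>s ! i)"
    and indecomposable: "\<And>i \<beta>s. i < 2 \<Longrightarrow> \<not> is_inflation \<pi> \<beta>s (\<alpha>s ! i)"
    and J: "J \<in> intervals \<sigma>" "J \<noteq> {1..n}"
  shows "\<exists>i<2. J \<subseteq> set (Bs ! i)"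
proof (rule ccontr)
  assume not_sub: "\<not> (\<exists>i<2. J \<subseteq> set (Bs ! i))"
  interpret block_decomposition \<sigma> \<pi> n 2 "\<lambda>i. set (Bs ! i)" by (rule blocks)
  obtain b c where bc: "Bs = [b, c]"
    using Bs(1) by (metis (no_types) Suc_length_conv length_0_conv numeral_2_eq_2)
  have \<sigma>: "\<sigma> = b @ c" using Bs(2) bc by simp
  have J_convex: "order_convex J" "order_convex (positions \<sigma> J)" and J_sub: "J \<subseteq> {1..n}"
    using J(1) \<sigma>_facts by (simp_all add: intervals_iff_order_convex)
  have "set b \<union> set c = {1..n}" using \<sigma> \<sigma>_facts(2) by simp
  moreover have "\<not> J \<subseteq> set b" "\<not> J \<subseteq> set c"
    using not_sub[unfolded not_ex, THEN spec, of 0] not_sub[unfolded not_ex, THEN spec, of 1] bc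
    by simp_all
  ultimately obtain x y where x: "x \<in> set b" "x \<in> J" and y: "y \<in> set c" "y \<in> J"
    using J_sub by blast
  have dir: "\<pi> ! 0 < \<pi> ! 1 \<and> (\<forall>x\<in>set b. \<forall>y\<in>set c. x < y) \<or>
      \<not> \<pi> ! 0 < \<pi> ! 1 \<and> (\<forall>x\<in>set b. \<forall>y\<in>set c. y < x)"
  proof (cases "\<pi> ! 0 < \<pi> ! 1")
    case True
    then show ?thesis using block_values_less[of 0 1] bc by simp
  next
    case False
    then have "\<pi> ! 1 < \<pi> ! 0" using nth_\<pi>_eq_iff[of 0 1] by linarith
    then show ?thesis using block_values_less[of 1 0] bc by simp
  qed
  obtain p where p: "p < length b" "b ! p = x" using x(1) by (auto simp: in_set_conv_nth)
  obtain q where q: "q < length c" "c ! q = y" using y(1) by (auto simp: in_set_conv_nth)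
  have pJ: "p \<in> positions \<sigma> J" and qJ: "length b + q \<in> positions \<sigma> J"
    using p q x y \<sigma> by (simp_all add: positions_def nth_append)
  obtain z where z: "z \<in> {1..n}" "z \<notin> J" using J(2) J_sub by blast
  then consider (first) "z \<in> set b" | (second) "z \<in> set c"
    using \<open>set b \<union> set c = {1..n}\<close> by blast
  then show False
  proof cases
    case first
    have "\<exists>\<beta>s. is_inflation \<pi> \<beta>s (\<alpha>s ! 0)"
    \<comment> \<open>The part next to the second block comes last, so the prefix is the part outside \<open>J\<close>.\<close>
    proof (rule inflation_of_two_by_cut[of \<pi> "\<alpha>s ! 0" b "- J"])
      show "\<exists>u<length b. b ! u \<in> - J" using first z by (auto simp: in_set_conv_nth)
      show "\<exists>v<length b. b ! v \<notin> - J" using p x by auto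
      fix u v assume uv: "u < length b" "v < length b" "b ! u \<in> - J" "b ! v \<notin> - J"
      have "v \<in> positions \<sigma> J" "u \<notin> positions \<sigma> J"
        using uv \<sigma> by (simp_all add: positions_def nth_append)
      then have "u < v" using order_convexD[OF J_convex(2) _ qJ, of v u] uv(1) by linarith
      moreover have "b ! u \<in> set b" "b ! v \<in> set b" using uv by simp_all
      then have "b ! u < b ! v \<longleftrightarrow> \<pi> ! 0 < \<pi> ! 1"
        using dir y uv(3,4) order_convexD[OF J_convex(1), of "b ! v" y "b ! u"]
          order_convexD[OF J_convex(1), of y "b ! v" "b ! u"]
        by (metis Compl_iff less_imp_le linorder_not_less)
      ultimately show "u < v \<and> (b ! u < b ! v \<longleftrightarrow> \<pi> ! 0 < \<pi> ! 1)" by simp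
    qed (use \<alpha>s[of 0] bc perm_\<pi> in auto)
    then show False using indecomposable[of 0] by simp
  next
    case second
    have "\<exists>\<beta>s. is_inflation \<pi> \<beta>s (\<alpha>s ! 1)"
    proof (rule inflation_of_two_by_cut[of \<pi> "\<alpha>s ! 1" c J])
      show "\<exists>v<length c. c ! v \<notin> J" using second z by (auto simp: in_set_conv_nth)
      show "\<exists>u<length c. c ! u \<in> J" using q y by auto
      fix u v assume uv: "u < length c" "v < length c" "c ! u \<in> J" "c ! v \<notin> J"
      have "length b + u \<in> positions \<sigma> J" "length b + v \<notin> positions \<sigma> J"
        using uv \<sigma> by (simp_all add: positions_def nth_append)
      then have "u < v"
        using order_convexD[OF J_convex(2) pJ, of "length b + u" "length b + v"] p(1) by linarith
      moreover have "c ! u \<in> set c" "c ! v \<in> set c" using uv by simp_all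
      then have "c ! u < c ! v \<longleftrightarrow> \<pi> ! 0 < \<pi> ! 1"
        using dir x uv(3,4) order_convexD[OF J_convex(1), of "c ! u" x "c ! v"]
          order_convexD[OF J_convex(1), of x "c ! u" "c ! v"]
        by (metis less_imp_le linorder_not_less)
      ultimately show "u < v \<and> (c ! u < c ! v \<longleftrightarrow> \<pi> ! 0 < \<pi> ! 1)" by simp
    qed (use \<alpha>s[of 1] bc perm_\<pi> in auto)
    then show False using indecomposable[of 1] by simp
  qed
qed

section \<open>Monotone and simple permutations\<close>

text \<open>
  A corner is an end of the word that carries an extreme value: deleting it leaves a set convex
  both in position and in value. Monotone permutations have corners at both ends, simple
  permutations have none.
\<close>

lemma delete_corner_interval:
  assumes "is_perm k \<pi>" "j = 0 \<or> j = k - 1" "\<pi> ! j = 1 \<or> \<pi> ! j = k"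
  shows "{1..k} - {\<pi> ! j} \<in> intervals \<pi>"
proof -
  note f = is_permD[OF assms(1)]
  have j: "j < k" using assms(2) f(4) by auto
  have "positions \<pi> ({1..k} - {\<pi> ! j}) = {..<k} - {j}"
    using positions_full[of \<pi>] f j
    by (auto simp: positions_Diff) (auto simp: positions_def nth_eq_iff_index_eq)
  moreover have "order_convex ({..<k} - {j})"
    using assms(2) by (intro order_convexI) auto
  moreover have "order_convex ({1..k} - {\<pi> ! j})"
    using assms(3) by (intro order_convexI) auto
  ultimately show ?thesis
    using f by (auto simp: intervals_iff_order_convex)
qed

lemma increasing_perm_corners:
  "2 \<le> k \<Longrightarrow> increasing_perm k ! 0 = 1 \<and> increasing_perm k ! (k - 1) = k"
  by (simp add: increasing_perm_def del: upt_Suc)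

lemma decreasing_perm_corners:
  "2 \<le> k \<Longrightarrow> decreasing_perm k ! 0 = k \<and> decreasing_perm k ! (k - 1) = 1"
  by (simp add: decreasing_perm_def rev_nth del: upt_Suc)

lemma simple_perm_corner:
  assumes "simple_perm \<pi>" "length \<pi> = k"
  shows "\<pi> ! 0 \<noteq> 1" "\<pi> ! 0 \<noteq> k"
proof -
  have k: "4 \<le> k" "is_perm k \<pi>" using assms by (simp_all add: simple_perm_def)
  let ?T = "{1..k} - {\<pi> ! 0}"
  have "\<pi> ! 0 \<in> {1..k}" using is_permD[OF k(2)] nth_mem[of 0 \<pi>] by simp
  then have "card ?T = k - 1" and proper: "?T \<noteq> {1..k}" by (simp, blast)
  then have card: "card ?T \<noteq> 0" "card ?T \<noteq> 1" using k(1) by linarith+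
  have "?T \<noteq> {}"
  proof
    assume "?T = {}"
    then have "card ?T = 0" by (simp only: card.empty)
    then show False using card(1) by contradiction
  qed
  moreover have "\<not> is_singleton ?T"
    unfolding is_singleton_altdef by (rule card(2))
  moreover have "?T \<in> intervals \<pi> \<longrightarrow> ?T \<noteq> {} \<longrightarrow> is_singleton ?T \<or> ?T = {1..k}"
    using assms by (simp add: simple_perm_def)
  ultimately have "?T \<notin> intervals \<pi>"
    using proper by argo
  moreover have "?T \<in> intervals \<pi>" if "\<pi> ! 0 = 1 \<or> \<pi> ! 0 = k"
    by (rule delete_corner_interval[OF k(2) _ that]) simp
  ultimately show "\<pi> ! 0 \<noteq> 1" "\<pi> ! 0 \<noteq> k"
    by argo+
qed

lemma simple_perm_not_monotone:
  assumes "simple_perm \<pi>"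
  shows "\<pi> \<noteq> increasing_perm k" "\<pi> \<noteq> decreasing_perm k"
proof -
  have k: "length (increasing_perm k) = k" "length (decreasing_perm k) = k"
    by (simp_all add: increasing_perm_def decreasing_perm_def)
  have "4 \<le> length \<pi>" using assms by (simp add: simple_perm_def)
  then show "\<pi> \<noteq> increasing_perm k" "\<pi> \<noteq> decreasing_perm k"
    using simple_perm_corner[OF assms refl] increasing_perm_corners[of k]
      decreasing_perm_corners[of k] k by auto
qed

lemma increasing_perm_2: "increasing_perm 2 = [1, 2]"
  and decreasing_perm_2: "decreasing_perm 2 = [2, 1]"
  by (simp_all add: increasing_perm_def decreasing_perm_def numeral_2_eq_2)

lemma moebius_intervals_blocks:
  assumes blocks: "block_decomposition \<sigma> \<pi> n k B" and k: "2 \<le> k"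
    and proper: "\<And>J. J \<in> intervals \<sigma> \<Longrightarrow> J \<noteq> {1..n} \<Longrightarrow> \<exists>i<k. J \<subseteq> B i"
    and I: "I \<in> intervals \<sigma>"
  shows "moebius (intervals \<sigma>) I {1..n} =
    (if I = {1..n} then 1 else if covered_by (intervals \<sigma>) I {1..n} then - 1
     else if I = {} then int k - 1 else 0)"
proof -
  interpret block_decomposition \<sigma> \<pi> n k B by (rule blocks)
  interpret intersection_family "intervals \<sigma>" "{1..n}"
    by (rule intersection_family_intervals[OF perm_\<sigma>])
  have C: "coatoms (intervals \<sigma>) {1..n} = B ` {..<k}"
    by (rule coatoms_eq_blocks[OF proper k])
  have disj: "C \<inter> D = {}" if "C \<in> coatoms (intervals \<sigma>) {1..n}"
    "D \<in> coatoms (intervals \<sigma>) {1..n}" "C \<noteq> D" for C D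
  proof -
    obtain i j where ij: "i < k" "C = B i" "j < k" "D = B j"
      using \<open>C \<in> _\<close> \<open>D \<in> _\<close> unfolding C by auto
    then have "i \<noteq> j" using \<open>C \<noteq> D\<close> by blast
    then show ?thesis using ij block_eqI[of i j] by blast
  qed
  have empty_not: "{} \<notin> coatoms (intervals \<sigma>) {1..n}"
    using block_nonempty unfolding C by fastforce
  have top_ne: "{1..n} \<noteq> {}" using \<sigma>_facts(4) by simp
  have "moebius (intervals \<sigma>) {} {1..n} = int (card (coatoms (intervals \<sigma>) {1..n})) - 1"
    using empty_not top_ne by (intro moebius_empty_disjoint_coatoms disj)
  moreover have "card (coatoms (intervals \<sigma>) {1..n}) = k"
    unfolding C using card_image[OF block_inj_on] by simp
  ultimately have empty: "moebius (intervals \<sigma>) {} {1..n} = int k - 1" by simp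
  have iff: "I \<in> coatoms (intervals \<sigma>) {1..n} \<longleftrightarrow> covered_by (intervals \<sigma>) I {1..n}"
    by (simp add: coatoms_def)
  consider "I = {1..n}" | "I \<noteq> {1..n}" "covered_by (intervals \<sigma>) I {1..n}" | "I = {}"
    | "I \<noteq> {1..n}" "\<not> covered_by (intervals \<sigma>) I {1..n}" "I \<noteq> {}"
    by blast
  then show ?thesis
  proof cases
    case 1
    then show ?thesis by (simp add: moebius_eqs(1)[OF finite_family])
  next
    case 2
    then show ?thesis by (simp add: moebius_coatom[OF finite_family])
  next
    case 3
    then show ?thesis using empty empty_not iff top_ne by simp
  next
    case 4
    then have "moebius (intervals \<sigma>) I {1..n} = 0"
      using I iff by (intro moebius_disjoint_coatoms disj) simp_all
    then show ?thesis using 4 by simp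
  qed
qed

lemma moebius_intervals_overlapping:
  assumes \<sigma>: "is_perm n \<sigma>"
    and CD: "C \<in> coatoms (intervals \<sigma>) {1..n}" "D \<in> coatoms (intervals \<sigma>) {1..n}"
    "C \<noteq> D" "C \<inter> D \<noteq> {}"
    and I: "I \<in> intervals \<sigma>"
  shows "moebius (intervals \<sigma>) I {1..n} =
    (if I = {1..n} then 1 else if covered_by (intervals \<sigma>) I {1..n} then - 1
     else if \<exists>C\<^sub>1 C\<^sub>2. C\<^sub>1 \<noteq> C\<^sub>2 \<and> coatoms (intervals \<sigma>) {1..n} = {C\<^sub>1, C\<^sub>2} \<and>
                covered_by (intervals \<sigma>) I C\<^sub>1 \<and> covered_by (intervals \<sigma>) I C\<^sub>2 then 1
     else 0)" (is "_ = (if _ then _ else if _ then _ else if ?two then _ else _)")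
proof -
  interpret intersection_family "intervals \<sigma>" "{1..n}"
    by (rule intersection_family_intervals[OF \<sigma>])
  have C: "coatoms (intervals \<sigma>) {1..n} = {C, D}"
    by (rule overlapping_coatoms_unique[OF \<sigma> CD])
  have cov: "covered_by (intervals \<sigma>) (C \<inter> D) C" "covered_by (intervals \<sigma>) (C \<inter> D) D"
    using covered_by_Int_overlapping_coatoms[OF \<sigma> CD]
      covered_by_Int_overlapping_coatoms[OF \<sigma> CD(2,1)] CD(3,4) by (simp_all add: Int_commute)
  have two_iff: "?two \<longleftrightarrow> I = C \<inter> D"
  proof
    assume ?two
    then obtain C' D' where "{C', D'} = {C, D}"
      "covered_by (intervals \<sigma>) I C'" "covered_by (intervals \<sigma>) I D'"
      unfolding C by (elim exE conjE) simp
    then have I_cov: "covered_by (intervals \<sigma>) I C" "covered_by (intervals \<sigma>) I D"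
      unfolding doubleton_eq_iff by metis+
    then have "I \<subset> C" "I \<subset> D" by (simp_all add: covered_by_def)
    then have "I \<subseteq> C \<inter> D" by blast
    moreover have "\<not> I \<subset> C \<inter> D"
    proof
      assume "I \<subset> C \<inter> D"
      moreover have "C \<inter> D \<in> intervals \<sigma>" "C \<inter> D \<subset> C"
        using cov(1) by (simp_all add: covered_by_def)
      ultimately show False using I_cov(1) by (simp add: covered_by_def)
    qed
    ultimately show "I = C \<inter> D" by blast
  next
    assume "I = C \<inter> D"
    then show ?two using C CD(3) cov by (intro exI[of _ C] exI[of _ D]) simp
  qed
  have M_top: "C \<inter> D \<noteq> {1..n}" using coatom_intervalD(2)[OF CD(1)] by blast
  have M_cov: "\<not> covered_by (intervals \<sigma>) (C \<inter> D) {1..n}"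
  proof
    assume "covered_by (intervals \<sigma>) (C \<inter> D) {1..n}"
    then have "C \<inter> D \<in> {C, D}" unfolding C[symmetric] by (simp add: coatoms_def)
    moreover have "C \<inter> D < C" "C \<inter> D < D" using cov by (simp_all add: covered_by_def)
    ultimately show False by (metis insertE less_irrefl singletonD)
  qed
  have coatom_iff: "I \<in> coatoms (intervals \<sigma>) {1..n} \<longleftrightarrow> covered_by (intervals \<sigma>) I {1..n}"
    by (simp add: coatoms_def)
  consider "I = {1..n}" | "I \<noteq> {1..n}" "covered_by (intervals \<sigma>) I {1..n}" | "I = C \<inter> D"
    | "I \<noteq> {1..n}" "\<not> covered_by (intervals \<sigma>) I {1..n}" "I \<noteq> C \<inter> D"
    by argo
  then show ?thesis
  proof cases
    case 1
    then show ?thesis by (simp add: moebius_eqs(1)[OF finite_family])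
  next
    case 2
    then show ?thesis by (simp add: moebius_coatom[OF finite_family])
  next
    case 3
    then have "moebius (intervals \<sigma>) I {1..n} = 1"
      using moebius_Int_two_coatoms[OF C CD(3) cov] by simp
    then show ?thesis using 3 M_top M_cov two_iff by simp
  next
    case 4
    then have "moebius (intervals \<sigma>) I {1..n} = 0"
      using moebius_two_coatoms[OF C CD(3) I] coatom_iff by simp
    then show ?thesis using 4 two_iff by simp
  qed
qed

theorem theorem29:
  fixes n k :: nat and \<sigma> \<pi> :: "nat list" and \<alpha>s :: "nat list list" and I :: "nat set"
  assumes "is_perm n \<sigma>"
    and "substitution_decomposition \<sigma> \<pi> \<alpha>s"
    and "length \<pi> = k"
    and "I \<in> intervals \<sigma>"
  shows "moebius (intervals \<sigma>) I {1..n} =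
    (if I = {1..n} then 1
     else if covered_by (intervals \<sigma>) I {1..n} then - 1
     else if I = {} \<and> (simple_perm \<pi> \<or> \<pi> = [1, 2] \<or> \<pi> = [2, 1]) then int k - 1
     else if k \<ge> 3 \<and> (\<pi> = increasing_perm k \<or> \<pi> = decreasing_perm k) \<and>
             (\<exists>C\<^sub>1 C\<^sub>2. C\<^sub>1 \<noteq> C\<^sub>2 \<and> coatoms (intervals \<sigma>) {1..n} = {C\<^sub>1, C\<^sub>2} \<and>
                covered_by (intervals \<sigma>) I C\<^sub>1 \<and> covered_by (intervals \<sigma>) I C\<^sub>2) then 1
     else 0)"
proof -
  have infl: "is_inflation \<pi> \<alpha>s \<sigma>"
    using assms(2) by (simp add: substitution_decomposition_def)
  then have \<pi>: "is_perm k \<pi>" and \<alpha>s: "length \<alpha>s = k" "\<forall>\<alpha> \<in> set \<alpha>s. is_perm (length \<alpha>) \<alpha>"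
    using assms(3) by (auto simp: is_inflation_def)
  obtain Bs where Bs: "length Bs = k" "concat Bs = \<sigma>"
    "\<And>i. i < k \<Longrightarrow> set (Bs ! i) \<in> intervals \<sigma>"
    and iso: "\<And>i. i < k \<Longrightarrow> order_isomorphic (Bs ! i) (\<alpha>s ! i)"
    and vals: "\<And>i j x y. i < k \<Longrightarrow> j < k \<Longrightarrow> \<pi> ! i < \<pi> ! j \<Longrightarrow> x \<in> set (Bs ! i) \<Longrightarrow>
      y \<in> set (Bs ! j) \<Longrightarrow> x < y"
    using infl assms(3) unfolding is_inflation_def by metis
  have \<alpha>s_perm: "is_perm (length (\<alpha>s ! i)) (\<alpha>s ! i)" if "i < k" for i
    using \<alpha>s that by auto
  have nonempty: "Bs ! i \<noteq> []" if "i < k" for i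
    using iso[OF that] is_permD(4)[OF \<alpha>s_perm[OF that]] by (auto simp: order_isomorphic_def)
  interpret block_decomposition \<sigma> \<pi> n k "\<lambda>i. set (Bs ! i)"
    by (rule block_decomposition_concat[OF assms(1) \<pi> Bs(1,2,3) nonempty vals])
  have blocks: "block_decomposition \<sigma> \<pi> n k (\<lambda>i. set (Bs ! i))" by unfold_locales
  consider (simple) "simple_perm \<pi>"
    | (two) "k = 2" "\<pi> = [1, 2] \<or> \<pi> = [2, 1]" "\<And>i \<beta>s. i < 2 \<Longrightarrow> \<not> is_inflation \<pi> \<beta>s (\<alpha>s ! i)"
    | (monotone) "3 \<le> k" "\<pi> = increasing_perm k \<or> \<pi> = decreasing_perm k"
  proof -
    have len: "length (increasing_perm l) = l" "length (decreasing_perm l) = l" for l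
      by (simp_all add: increasing_perm_def decreasing_perm_def)
    have "simple_perm \<pi> \<or> 2 \<le> k \<and>
        (\<pi> = increasing_perm k \<and> (\<forall>\<alpha> \<in> set \<alpha>s. oplus_indecomposable \<alpha>) \<or>
         \<pi> = decreasing_perm k \<and> (\<forall>\<alpha> \<in> set \<alpha>s. ominus_indecomposable \<alpha>))"
      using assms(2,3) len unfolding substitution_decomposition_def by metis
    then consider "simple_perm \<pi>" | "3 \<le> k" "\<pi> = increasing_perm k \<or> \<pi> = decreasing_perm k"
      | "k = 2" "\<pi> = increasing_perm 2" "\<forall>\<alpha> \<in> set \<alpha>s. oplus_indecomposable \<alpha>"
      | "k = 2" "\<pi> = decreasing_perm 2" "\<forall>\<alpha> \<in> set \<alpha>s. ominus_indecomposable \<alpha>"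
      by (cases "k = 2") auto
    then show thesis
    proof cases
      case 3
      have "\<not> is_inflation \<pi> \<beta>s (\<alpha>s ! i)" if "i < 2" for i \<beta>s
      proof -
        have "oplus_indecomposable (\<alpha>s ! i)" using 3(1,3) \<alpha>s(1) that by simp
        then show ?thesis unfolding 3(2) oplus_indecomposable_def by (metis order_refl)
      qed
      then show thesis using two 3 increasing_perm_2 by simp
    next
      case 4
      have "\<not> is_inflation \<pi> \<beta>s (\<alpha>s ! i)" if "i < 2" for i \<beta>s
      proof -
        have "ominus_indecomposable (\<alpha>s ! i)" using 4(1,3) \<alpha>s(1) that by simp
        then show ?thesis unfolding 4(2) ominus_indecomposable_def by (metis order_refl)
      qed
      then show thesis using two 4 decreasing_perm_2 by simp
    qed (use simple monotone in auto)
  qed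
  then show ?thesis
  proof cases
    case simple
    have "2 \<le> k" using simple assms(3) by (simp add: simple_perm_def)
    then have "moebius (intervals \<sigma>) I {1..n} =
      (if I = {1..n} then 1 else if covered_by (intervals \<sigma>) I {1..n} then - 1
       else if I = {} then int k - 1 else 0)"
      by (rule moebius_intervals_blocks[OF blocks _
            proper_interval_subset_block_simple[OF simple] assms(4)])
    then show ?thesis using simple simple_perm_not_monotone[OF simple, of k] by simp
  next
    case two
    have "\<exists>i<k. J \<subseteq> set (Bs ! i)" if J: "J \<in> intervals \<sigma>" "J \<noteq> {1..n}" for J
      unfolding two(1)
    proof (rule proper_interval_subset_block_two[OF blocks[unfolded two(1)]
          Bs(1)[unfolded two(1)] Bs(2) _ two(3) J])
      show "is_perm (length (\<alpha>s ! i)) (\<alpha>s ! i) \<and> order_isomorphic (Bs ! i) (\<alpha>s ! i)"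
        if "i < 2" for i
        using \<alpha>s_perm[of i] iso[of i] that two(1) by simp
    qed
    moreover have "2 \<le> k" using two(1) by simp
    ultimately have "moebius (intervals \<sigma>) I {1..n} =
      (if I = {1..n} then 1 else if covered_by (intervals \<sigma>) I {1..n} then - 1
       else if I = {} then int k - 1 else 0)"
      by (intro moebius_intervals_blocks[OF blocks] assms(4))
    moreover have "\<not> 3 \<le> k" using two(1) by simp
    ultimately show ?thesis using two(2) by simp
  next
    case monotone
    have not_simple: "\<not> (simple_perm \<pi> \<or> \<pi> = [1, 2] \<or> \<pi> = [2, 1])"
    proof -
      have "length \<pi> \<noteq> 2" using monotone(1) assms(3) by simp
      then have "\<pi> \<noteq> [1, 2]" "\<pi> \<noteq> [2, 1]" by force+
      then show ?thesis using monotone(2) simple_perm_not_monotone by blast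
    qed
    have "2 \<le> k" using monotone(1) by simp
    then have "\<pi> ! 0 = 1 \<or> \<pi> ! 0 = k" "\<pi> ! (k - 1) = 1 \<or> \<pi> ! (k - 1) = k"
      using monotone(2) increasing_perm_corners decreasing_perm_corners by metis+
    then have "{1..k} - {\<pi> ! 0} \<in> intervals \<pi>" "{1..k} - {\<pi> ! (k - 1)} \<in> intervals \<pi>"
      by (intro delete_corner_interval[OF \<pi>]; simp)+
    with monotone(1) obtain C D where CD: "C \<in> coatoms (intervals \<sigma>) {1..n}"
      "D \<in> coatoms (intervals \<sigma>) {1..n}" "C \<noteq> D" "C \<inter> D \<noteq> {}"
      by (rule overlapping_coatoms_exist)
    have "(3 \<le> k \<and> (\<pi> = increasing_perm k \<or> \<pi> = decreasing_perm k) \<and> Q) = Q" for Q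
      using monotone by simp
    then show ?thesis
      using not_simple
      by (simp only: moebius_intervals_overlapping[OF assms(1) CD assms(4)] simp_thms if_False)
  qed
qed

end
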